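(* (1) For every $\varepsilon>0$ there is a constant $C_\varepsilon>0$ such that for every prime $p$, every proper multiplicative subgroup $\Gamma\subsetneq\mathbb{F}_p^*$ and every arithmetic progression $P\subseteq\Gamma$, $$|P|\le C_\varepsilon|\Gamma|^{\frac12+\varepsilon}.$$ (2) For every $\varepsilon>0$, every $C>0$ and every integer $l\ge3$ there is a constant $C'=C'(\varepsilon,C,l)>0$ such that for every prime $p$, every proper multiplicative subgroup $\Gamma\subsetneq\mathbb{F}_p^*$ with $2\le|\Gamma|\le Cp^{2/3}$ and every arithmetic progression $P\subseteq\Gamma$, $$\mathsf{E}(P,\Gamma)\le C'|P|^{1+\varepsilon}|\Gamma|\log^{\frac12}|\Gamma|\qquad\text{and}\qquad \mathsf{E}_l(P,\Gamma)\le C'|P|^{1+\varepsilon}|\Gamma|^{l-1}.$$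
   Context: $\mathbb{F}_p=\mathbb{Z}/p\mathbb{Z}$, $\mathbb{F}_p^*=\mathbb{F}_p\setminus\{0\}$. An arithmetic progression in $\mathbb{F}_p$ is a set of the form $\{a+jd:0\le j<s\}$ with $d\ne0$, $1\le s\le p$. For sets $A,B\subseteq\mathbb{F}_p$, $(A\circ A)(x)=|\{(a,a')\in A\times A:a'-a=x\}|$, $\mathsf{E}(A,B)=\sum_x(A\circ A)(x)(B\circ B)(x)$, and $\mathsf{E}_l(A,B)=\sum_x(A\circ A)(x)\,(B\circ B)(x)^{l-1}$. Logarithms are to base $2$. *)

theory Defs
  imports Complex_Main "HOL-Number_Theory.Residues"
begin

abbreviation Fp :: "nat \<Rightarrow> int ring"
  where "Fp p \<equiv> residue_ring (int p)"

definition proper_mult_subgroup :: "nat \<Rightarrow> int set \<Rightarrow> bool"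
  where "proper_mult_subgroup p G \<longleftrightarrow>
    subgroup G (mult_of (Fp p)) \<and> G \<noteq> carrier (mult_of (Fp p))"

definition arith_progression :: "nat \<Rightarrow> int set \<Rightarrow> bool"
  where "arith_progression p P \<longleftrightarrow>
    (\<exists>a\<in>carrier (Fp p). \<exists>d\<in>carrier (Fp p) - {\<zero>\<^bsub>Fp p\<^esub>}. \<exists>s::nat. 1 \<le> s \<and> s \<le> p \<and>
      P = {a \<oplus>\<^bsub>Fp p\<^esub> [j] \<cdot>\<^bsub>Fp p\<^esub> d | j::nat. j < s})"

text \<open>\<open>diff_count p A x\<close> is \<open>(A \<circ> A)(x)\<close>.\<close>

definition diff_count :: "nat \<Rightarrow> int set \<Rightarrow> int \<Rightarrow> nat"
  where "diff_count p A x = card {(a, a'). a \<in> A \<and> a' \<in> A \<and> a' \<ominus>\<^bsub>Fp p\<^esub> a = x}"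

definition energy :: "nat \<Rightarrow> int set \<Rightarrow> int set \<Rightarrow> nat"
  where "energy p A B = (\<Sum>x\<in>carrier (Fp p). diff_count p A x * diff_count p B x)"

text \<open>The exponent \<open>l - 1\<close> falls on the second set only, so this is not symmetric in \<open>A\<close> and \<open>B\<close>;
  it is meant for \<open>l \<ge> 1\<close>, where the subtraction does not truncate.\<close>

definition higher_energy :: "nat \<Rightarrow> nat \<Rightarrow> int set \<Rightarrow> int set \<Rightarrow> nat"
  where "higher_energy p l A B =
    (\<Sum>x\<in>carrier (Fp p). diff_count p A x * diff_count p B x ^ (l - 1))"

end

theory Submission
  imports Defs "HOL-Computational_Algebra.Polynomial"
begin

text \<open>
  Let \<open>t = |\<Gamma>|\<close> and let \<open>P \<subseteq> \<Gamma>\<close> be a progression of length \<open>s\<close> and step \<open>d\<close>. If \<open>u\<close>, \<open>u + jd\<close>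
  and \<open>u + 2jd\<close> lie in \<open>P\<close>, then the ratio \<open>g = (u + jd) / u\<close> satisfies \<open>g \<in> \<Gamma>\<close> and
  \<open>2g - 1 \<in> \<Gamma>\<close>. Two such ratios rarely coincide: Cauchy--Schwarz and a sum of greatest common
  divisors produce at least \<open>c s\<^sup>2 / log s\<close> of them, provided that \<open>s\<close> is at most a multiple of \<open>sqrt p\<close>.
  The latter holds for every proper subgroup by a second moment computation over all
  progressions of length about \<open>s / 2\<close>. Comparing the number of ratios with \<open>t\<close> gives part (1).

  For \<open>t \<le> C p\<^sup>2\<^sup>/\<^sup>3\<close>, Stepanov's method bounds the number of solutions of \<open>\<alpha> g + \<beta> h = 1\<close> in
  \<open>\<Gamma>\<close> by \<open>O(t\<^sup>2\<^sup>/\<^sup>3)\<close>. Applied to \<open>2 g - h = 1\<close> this improves the bound on the progression to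
  \<open>s \<le> C' t\<^sup>1\<^sup>/\<^sup>3 s\<^sup>\<epsilon>\<close>; applied to \<open>h - g = x\<close> it bounds \<open>(\<Gamma> \<circ> \<Gamma>)(x)\<close> for \<open>x \<noteq> 0\<close>. Both energies then
  split into the term \<open>x = 0\<close> and a remainder of at most \<open>s\<^sup>2 O(t\<^sup>2\<^sup>/\<^sup>3)\<^sup>l\<^sup>-\<^sup>1\<close>.
\<close>

subsection \<open>Polynomials modulo a prime\<close>

text \<open>Pigeonhole: there are p^|I| vectors with entries in [0, p) but only p^|J| possible
  values of the system modulo p, so two vectors collide; their difference is the solution.\<close>

lemma homogeneous_system_mod:
  fixes c :: "'i \<Rightarrow> 'j \<Rightarrow> int" and p :: nat
  assumes fin: "finite I" "finite J" and card: "card J < card I" and p: "1 < p"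
  shows "\<exists>l. (\<exists>i\<in>I. \<not> int p dvd l i) \<and> (\<forall>j\<in>J. int p dvd (\<Sum>i\<in>I. c i j * l i))"
proof -
  let ?X = "PiE I (\<lambda>_. {0..<int p})"
  let ?Y = "PiE J (\<lambda>_. {0..<int p})"
  define F where "F = (\<lambda>l. restrict (\<lambda>j. (\<Sum>i\<in>I. c i j * l i) mod int p) J)"
  have "F ` ?X \<subseteq> ?Y"
    using p by (auto simp: F_def)
  moreover have "card ?Y < card ?X"
    using fin card p by (simp add: card_PiE power_strict_increasing)
  moreover have "finite ?Y"
    using fin by (intro finite_PiE) auto
  ultimately have "\<not> inj_on F ?X"
    by (meson card_inj_on_le leD)
  then obtain l l' where l: "l \<in> ?X" "l' \<in> ?X" "F l = F l'" "l \<noteq> l'"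
    by (auto simp: inj_on_def)
  then obtain i where i: "i \<in> I" "l i \<noteq> l' i"
    by (meson PiE_ext)
  have "\<not> int p dvd l i - l' i"
  proof
    assume "int p dvd l i - l' i"
    then have "l i mod int p = l' i mod int p"
      by (simp add: mod_eq_dvd_iff)
    moreover have "l i \<in> {0..<int p}" "l' i \<in> {0..<int p}"
      using l i by (auto simp: PiE_mem)
    ultimately show False
      using i by simp
  qed
  moreover have "int p dvd (\<Sum>i\<in>I. c i j * (l i - l' i))" if "j \<in> J" for j
  proof -
    have "(\<Sum>i\<in>I. c i j * l i) mod int p = (\<Sum>i\<in>I. c i j * l' i) mod int p"
      using fun_cong[OF l(3), of j] that by (simp add: F_def)
    then show ?thesis
      by (simp add: mod_eq_dvd_iff sum_subtractf right_diff_distrib)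
  qed
  ultimately show ?thesis
    using i(1) by (intro exI[of _ "\<lambda>i. l i - l' i"]) auto
qed

text \<open>This is the action of X d/dX = (X - 1) d/dX + d/dX on X^m, read off in Taylor
  coefficients at X = 1.\<close>

lemma times_binomial_int:
  "int m * int (m choose k) = int (Suc k) * int (m choose Suc k) + int k * int (m choose k)"
proof (induction m arbitrary: k)
  case 0
  then show ?case by (cases k) auto
next
  case (Suc m)
  show ?case
  proof (cases k)
    case (Suc j)
    then show ?thesis
      using Suc.IH[of k] Suc.IH[of j] by (simp add: algebra_simps)
  qed simp
qed

text \<open>The hypothesis says that \<open>\<Sum>m\<in>S. f m X\<^sup>m\<close> vanishes modulo \<open>p\<close> to order \<open>|S|\<close> at \<open>X = 1\<close>. Applying
  \<open>X d/dX - n\<close> removes the term \<open>X\<^sup>n\<close> and lowers the order by one.\<close>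

lemma sparse_binomial_mod:
  fixes f :: "nat \<Rightarrow> int" and p :: nat
  assumes "prime p" "finite S" "S \<subseteq> {..<p}"
    and "\<And>k. k < card S \<Longrightarrow> int p dvd (\<Sum>m\<in>S. f m * int (m choose k))"
    and "m \<in> S"
  shows "int p dvd f m"
  using assms(2-)
proof (induction S arbitrary: f m rule: finite_induct)
  case (insert n S)
  let ?T = "insert n S"
  have S: "int p dvd f m" if m: "m \<in> S" for m
  proof -
    have "int p dvd (int m - int n) * f m"
    proof (rule insert.IH[where f = "\<lambda>m. (int m - int n) * f m"])
      fix k assume k: "k < card S"
      have "(\<Sum>m\<in>S. (int m - int n) * f m * int (m choose k)) =
          (\<Sum>m\<in>?T. (int m - int n) * f m * int (m choose k))"
        using insert.hyps by simp
      also have "\<dots> = (\<Sum>m\<in>?T. f m * (int m * int (m choose k)) - int n * (f m * int (m choose k)))"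
        by (intro sum.cong) (simp_all add: algebra_simps)
      also have "\<dots> = (\<Sum>m\<in>?T. int (Suc k) * (f m * int (m choose Suc k)) +
          (int k - int n) * (f m * int (m choose k)))"
        unfolding times_binomial_int by (intro sum.cong) (simp_all add: algebra_simps)
      also have "\<dots> = int (Suc k) * (\<Sum>m\<in>?T. f m * int (m choose Suc k)) +
          (int k - int n) * (\<Sum>m\<in>?T. f m * int (m choose k))"
        by (simp only: sum.distrib sum_distrib_left)
      also have "int p dvd \<dots>"
        using insert.prems(2)[of "Suc k"] insert.prems(2)[of k] k insert.hyps
        by (intro dvd_add dvd_mult) auto
      finally show "int p dvd (\<Sum>m\<in>S. (int m - int n) * f m * int (m choose k))" .
    qed (use insert.prems m in auto)
    \<comment> \<open>Distinct exponents below p stay distinct modulo p, so the factor m - n can be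
      cancelled.\<close>
    moreover have "\<not> int p dvd int m - int n"
    proof -
      have "m \<noteq> n" "m < p" "n < p"
        using m insert by auto
      then show ?thesis
        using dvd_imp_le_int[of "int m - int n" "int p"] by auto
    qed
    ultimately show ?thesis
      using assms(1) by (simp add: prime_dvd_mult_iff)
  qed
  show ?case
  proof (cases "m \<in> S")
    case False
    then have "m = n"
      using insert.prems by simp
    \<comment> \<open>The condition for k = 0 says that all coefficients sum to 0, and all but the
      one at \<open>n\<close> are already known to vanish.\<close>
    have "int p dvd f n + (\<Sum>m\<in>S. f m)"
      using insert.prems(2)[of 0] insert.hyps by simp
    moreover have "int p dvd (\<Sum>m\<in>S. f m)"
      using S by (intro dvd_sum) auto
    ultimately show ?thesis
      using \<open>m = n\<close> by (simp add: dvd_add_left_iff)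
  qed (use S in auto)
qed simp

section \<open>Divisibility and comaximality of integer polynomials modulo p\<close>

definition dvd_mod :: "int \<Rightarrow> int poly \<Rightarrow> int poly \<Rightarrow> bool"
  where "dvd_mod p f g \<longleftrightarrow> (\<exists>h r. g = f * h + smult p r)"

text \<open>A Bezout identity modulo p; as in \<open>dvd_mod\<close>, the error is an explicit
  multiple of p, so that all computations stay in integer polynomials.\<close>

definition comaximal_mod :: "int \<Rightarrow> int poly \<Rightarrow> int poly \<Rightarrow> bool"
  where "comaximal_mod p f g \<longleftrightarrow> (\<exists>u v w. u * f + v * g = 1 + smult p w)"

lemma comaximal_mod_sym: "comaximal_mod p f g \<Longrightarrow> comaximal_mod p g f"
  unfolding comaximal_mod_def by (metis add.commute)

lemma comaximal_mod_1: "comaximal_mod p f 1"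
  unfolding comaximal_mod_def by (rule exI[of _ 0], rule exI[of _ 1], rule exI[of _ 0]) simp

lemma comaximal_mod_mult:
  assumes "comaximal_mod p f g" "comaximal_mod p f h"
  shows "comaximal_mod p f (g * h)"
proof -
  obtain u v w u' v' w' where *: "u * f + v * g = 1 + smult p w" "u' * f + v' * h = 1 + smult p w'"
    using assms by (auto simp: comaximal_mod_def)
  have "(u * u' * f + u * v' * h + v * g * u') * f + (v * v') * (g * h) = (u * f + v * g) * (u' * f + v' * h)"
    by (simp add: algebra_simps)
  also have "\<dots> = 1 + smult p (w + w' + smult p (w * w'))"
    unfolding * by (simp add: algebra_simps smult_add_right)
  finally show ?thesis
    unfolding comaximal_mod_def by blast
qed

lemma comaximal_mod_power: "comaximal_mod p f g \<Longrightarrow> comaximal_mod p f (g ^ n)"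
  by (induction n) (auto intro: comaximal_mod_1 comaximal_mod_mult)

lemma comaximal_mod_prod:
  "(\<And>i. i \<in> I \<Longrightarrow> comaximal_mod p f (g i)) \<Longrightarrow> comaximal_mod p f (prod g I)"
  by (induction I rule: infinite_finite_induct) (auto intro: comaximal_mod_1 comaximal_mod_mult)

text \<open>With e inverse to x - y modulo p, the combination -e (X - x) + e (X - y) = e (x - y) is
  1 modulo p.\<close>

lemma comaximal_mod_linear:
  assumes "prime p" "\<not> int p dvd x - y"
  shows "comaximal_mod (int p) [:- x, 1:] [:- y, 1:]"
proof -
  have "coprime (x - y) (int p)"
    using assms by (metis coprime_commute prime_imp_coprime prime_int_nat_transfer prime_nat_int_transfer)
  then obtain e where "[(x - y) * e = 1] (mod int p)"
    using cong_solve_coprime_int by blast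
  then obtain w where w: "(x - y) * e = 1 + int p * w"
    by (metis cong_iff_lin cong_sym)
  have "[:- e:] * [:- x, 1:] + [:e:] * [:- y, 1:] = 1 + smult (int p) [:w:]"
    using w by (simp add: algebra_simps one_pCons)
  then show ?thesis
    unfolding comaximal_mod_def by blast
qed

text \<open>Multiply the Bezout identity by q. In u f q replace q by its multiple of g, in v g q by
  its multiple of f; both terms become multiples of f g modulo p.\<close>

lemma dvd_mod_mult:
  assumes "comaximal_mod p f g" "dvd_mod p f q" "dvd_mod p g q"
  shows "dvd_mod p (f * g) q"
proof -
  obtain u v w where *: "u * f + v * g = 1 + smult p w"
    using assms(1) unfolding comaximal_mod_def by blast
  obtain h r where q: "q = f * h + smult p r"
    using assms(2) unfolding dvd_mod_def by blast
  obtain h' r' where q': "q = g * h' + smult p r'"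
    using assms(3) unfolding dvd_mod_def by blast
  have "q + smult p (w * q) = (u * f) * q + (v * g) * q"
    using arg_cong[OF *, of "\<lambda>z. z * q"] by (simp add: algebra_simps)
  also have "\<dots> = (u * f) * (g * h' + smult p r') + (v * g) * (f * h + smult p r)"
    by (simp only: q[symmetric] q'[symmetric])
  finally have "q = (f * g) * (u * h' + v * h) + smult p (u * f * r' + v * g * r - w * q)"
    by (simp add: algebra_simps smult_add_right smult_diff_right)
  then show ?thesis
    unfolding dvd_mod_def by blast
qed

lemma dvd_mod_prod_linear_power:
  assumes "prime p" "finite M" "M \<subseteq> {0..<int p}"
    and "\<And>y. y \<in> M \<Longrightarrow> dvd_mod (int p) ([:- y, 1:] ^ D) q"
  shows "dvd_mod (int p) (\<Prod>y\<in>M. [:- y, 1:] ^ D) q"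
  using assms(2-)
proof (induction M rule: finite_induct)
  case empty
  show ?case
    unfolding dvd_mod_def by (rule exI[of _ q], rule exI[of _ 0]) simp
next
  case (insert x M)
  have "comaximal_mod (int p) [:- x, 1:] [:- y, 1:]" if "y \<in> M" for y
  proof (rule comaximal_mod_linear[OF assms(1)])
    have "x \<noteq> y" "x \<in> {0..<int p}" "y \<in> {0..<int p}"
      using that insert by auto
    then show "\<not> int p dvd x - y"
      using dvd_imp_le_int[of "x - y" "int p"] by auto
  qed
  then have "comaximal_mod (int p) ([:- x, 1:] ^ D) (\<Prod>y\<in>M. [:- y, 1:] ^ D)"
    by (intro comaximal_mod_prod comaximal_mod_power)
      (metis comaximal_mod_power comaximal_mod_sym)
  then show ?case
    using insert by (simp add: dvd_mod_mult)
qed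

text \<open>This serves as the bound of the number of roots with multiplicity by the degree. If the
  cofactor were nonzero modulo p, its top coefficient modulo p would survive in the product in a
  degree where q has none.\<close>

lemma dvd_mod_monic_degree_less:
  assumes "prime p" "dvd_mod (int p) f q" "lead_coeff f = 1" "degree q < degree f"
  shows "int p dvd coeff q i"
proof -
  obtain h r where q: "q = f * h + smult (int p) r"
    using assms(2) by (auto simp: dvd_mod_def)
  have h: "int p dvd coeff h n" for n
  proof (rule ccontr)
    assume "\<not> int p dvd coeff h n"
    \<comment> \<open>The leading coefficients of \<open>h\<close> may be multiples of p;
      \<open>m\<close> is its degree modulo p.\<close>
    define m where "m = (GREATEST m. \<not> int p dvd coeff h m)"
    have bound: "m \<le> degree h" if "\<not> int p dvd coeff h m" for m
      using that by (metis dvd_0_right le_degree)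
    have m: "\<not> int p dvd coeff h m"
      unfolding m_def using \<open>\<not> int p dvd coeff h n\<close> bound by (rule GreatestI_nat)
    have m': "int p dvd coeff h k" if "k > m" for k
      using Greatest_le_nat[of "\<lambda>m. \<not> int p dvd coeff h m" k "degree h"] bound that
      unfolding m_def by (meson leD)
    let ?d = "degree f"
    have "coeff (f * h) (?d + m) = (\<Sum>i\<le>?d + m. coeff f i * coeff h (?d + m - i))"
      by (simp add: coeff_mult)
    also have "\<dots> = coeff f ?d * coeff h (?d + m - ?d) +
        (\<Sum>i\<in>{..?d + m} - {?d}. coeff f i * coeff h (?d + m - i))"
      by (subst sum.remove[of _ ?d]) auto
    finally have eq: "coeff (f * h) (?d + m) = coeff h m +
        (\<Sum>i\<in>{..?d + m} - {?d}. coeff f i * coeff h (?d + m - i))"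
      using assms(3) by simp
    have "int p dvd (\<Sum>i\<in>{..?d + m} - {?d}. coeff f i * coeff h (?d + m - i))"
    proof (intro dvd_sum)
      fix i assume "i \<in> {..?d + m} - {?d}"
      then consider "i < ?d" | "i > ?d"
        by fastforce
      then show "int p dvd coeff f i * coeff h (?d + m - i)"
      proof cases
        case 1
        then show ?thesis by (intro dvd_mult m') auto
      qed (simp add: coeff_eq_0)
    qed
    moreover have "int p dvd coeff (f * h) (?d + m)"
    proof -
      have "coeff q (?d + m) = 0"
        using assms(4) by (intro coeff_eq_0) auto
      then have "coeff (f * h) (?d + m) = - int p * coeff r (?d + m)"
        unfolding q by simp
      then show ?thesis by simp
    qed
    ultimately show False
      using m unfolding eq by (simp add: dvd_add_left_iff)
  qed
  have "int p dvd (\<Sum>j\<le>i. coeff f j * coeff h (i - j))"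
    by (intro dvd_sum dvd_mult h)
  then show ?thesis
    unfolding q by (simp add: coeff_mult)
qed

lemma pcompose_power: "pcompose (q ^ n) r = pcompose q r ^ n"
  for q r :: "'a::comm_semiring_1 poly"
  by (induction n) (simp_all add: pcompose_1 pcompose_mult)

text \<open>The coefficients of q(X + y) are the Taylor coefficients of q at y; using them instead
  of derivatives avoids division by factorials. Split off X^D and substitute X - y back.\<close>

lemma dvd_mod_linear_power:
  assumes "\<And>k. k < D \<Longrightarrow> p dvd coeff (pcompose q [:y, 1:]) k"
  shows "dvd_mod p ([:- y, 1:] ^ D) q"
proof -
  define s where "s = pcompose q [:y, 1:]"
  define r where "r = (\<Sum>k<D. monom (coeff s k div p) k)"
  have "s = monom 1 D * poly_shift D s + smult p r"
  proof (rule poly_eqI)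
    fix k
    have "coeff r k = (if k < D then coeff s k div p else 0)"
      unfolding r_def by (simp add: coeff_sum)
    then show "coeff s k = coeff (monom 1 D * poly_shift D s + smult p r) k"
      using assms[of k] by (auto simp: coeff_monom_mult coeff_poly_shift s_def)
  qed
  then have "pcompose s [:- y, 1:] =
      pcompose (monom 1 D * poly_shift D s + smult p r) [:- y, 1:]"
    by simp
  also have "pcompose s [:- y, 1:] = q"
    unfolding s_def by (simp add: pcompose_assoc[symmetric] pcompose_pCons)
  also have "monom 1 D = [:0, 1:] ^ D"
    by (simp add: monom_altdef)
  finally show ?thesis
    unfolding dvd_mod_def
    by (auto simp: pcompose_add pcompose_mult pcompose_smult pcompose_power pcompose_pCons)
qed

subsection \<open>Stepanov's bound\<close>

text \<open>The factor a^i removes the truncated exponent n - i, so that the identity also covers i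
  > n.\<close>

lemma coeff_linear_power_times:
  "coeff ([:a, 1:] ^ n) i * a ^ i = int (n choose i) * a ^ n" for a :: int
proof (cases "i \<le> n")
  case True
  then show ?thesis
    by (simp add: coeff_linear_poly_power mult.assoc flip: power_add)
next
  case False
  then show ?thesis
    by (simp add: coeff_eq_0 degree_linear_power binomial_eq_0)
qed

text \<open>The factor \<open>(y (1 + y))\<^sup>k\<close> makes all exponents on the right at least \<open>n\<close> and \<open>m\<close>, so that for
  \<open>m = a + b t\<close> and \<open>n = c t\<close> the known values of \<open>y\<^sup>t\<close> and \<open>(1 + y)\<^sup>t\<close> leave a polynomial in \<open>y\<close> of
  degree at most \<open>a + k\<close>.\<close>

lemma taylor_coeff_monom_times_power:
  fixes y :: int
  shows "(y * (1 + y)) ^ k * coeff (pcompose (monom 1 n * [:1, 1:] ^ m) [:y, 1:]) k =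
    (\<Sum>i\<le>k. int (m choose i) * int (n choose (k - i)) * ((1 + y) ^ (m + (k - i)) * y ^ (n + i)))"
proof -
  have "pcompose (monom 1 n * [:1, 1:] ^ m) [:y, 1:] = [:1 + y, 1:] ^ m * [:y, 1:] ^ n"
    by (simp add: monom_altdef pcompose_mult pcompose_power pcompose_pCons mult.commute)
  then have "(y * (1 + y)) ^ k * coeff (pcompose (monom 1 n * [:1, 1:] ^ m) [:y, 1:]) k =
      (\<Sum>i\<le>k. (y * (1 + y)) ^ k * (coeff ([:1 + y, 1:] ^ m) i * coeff ([:y, 1:] ^ n) (k - i)))"
    by (simp add: coeff_mult sum_distrib_left)
  also have "\<dots> = (\<Sum>i\<le>k. int (m choose i) * int (n choose (k - i)) *
      ((1 + y) ^ (m + (k - i)) * y ^ (n + i)))"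
  proof (intro sum.cong refl)
    fix i assume "i \<in> {..k}"
    then have k: "y ^ k = y ^ (k - i) * y ^ i" "(1 + y) ^ k = (1 + y) ^ i * (1 + y) ^ (k - i)"
      by (simp_all flip: power_add)
    have "(y * (1 + y)) ^ k * (coeff ([:1 + y, 1:] ^ m) i * coeff ([:y, 1:] ^ n) (k - i)) =
        (coeff ([:1 + y, 1:] ^ m) i * (1 + y) ^ i) * (coeff ([:y, 1:] ^ n) (k - i) * y ^ (k - i)) *
        (1 + y) ^ (k - i) * y ^ i"
      unfolding power_mult_distrib k by (simp add: mult_ac)
    also have "\<dots> = int (m choose i) * int (n choose (k - i)) *
        ((1 + y) ^ (m + (k - i)) * y ^ (n + i))"
      unfolding coeff_linear_power_times by (simp add: power_add mult_ac)
    finally show "(y * (1 + y)) ^ k * (coeff ([:1 + y, 1:] ^ m) i * coeff ([:y, 1:] ^ n) (k - i)) =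
        int (m choose i) * int (n choose (k - i)) * ((1 + y) ^ (m + (k - i)) * y ^ (n + i))" .
  qed
  finally show ?thesis .
qed

text \<open>Modulo the vanishing coefficients with smaller \<open>c\<close>, the coefficients number \<open>c t\<close> to
  \<open>c t + t - 1\<close> of the sum only see the block \<open>c\<close>, which is sparse as a polynomial in \<open>1 + X\<close>.\<close>

lemma independent_mod:
  fixes p t K L :: nat and l :: "nat \<times> nat \<times> nat \<Rightarrow> int"
  defines "I \<equiv> {..<K} \<times> {..<L} \<times> {..<L}"
  assumes "prime p" "K * L \<le> t" "K + L * t \<le> p"
    and dvd: "\<And>e. int p dvd
      coeff (\<Sum>(a, b, c)\<in>I. smult (l (a, b, c)) (monom 1 (c * t) * [:1, 1:] ^ (a + b * t))) e"
    and "a < K" "b < L" "c < L"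
  shows "int p dvd l (a, b, c)"
  using assms(6-)
proof (induction c arbitrary: a b rule: less_induct)
  case (less c)
  have "K * 1 \<le> K * L"
    using less.prems by (intro mult_le_mono) auto
  \<comment> \<open>Hence a and b are the remainder and the quotient of a + b t by t and can be
    recovered from it.\<close>
  then have Kt: "K \<le> t"
    using assms(3) by linarith
  define S where "S = (\<lambda>(a, b). a + b * t) ` ({..<K} \<times> {..<L})"
  have inj: "inj_on (\<lambda>(a, b). a + b * t) ({..<K} \<times> {..<L})"
  proof (rule inj_on_inverseI[where g = "\<lambda>m. (m mod t, m div t)"])
    fix x assume "x \<in> {..<K} \<times> {..<L}"
    then show "(\<lambda>m. (m mod t, m div t)) ((\<lambda>(a, b). a + b * t) x) = x"
      using Kt by auto
  qed
  have S: "finite S" "card S = K * L" "S \<subseteq> {..<p}"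
  proof -
    show "card S = K * L"
      unfolding S_def using card_image[OF inj] by simp
    show "S \<subseteq> {..<p}"
    proof
      fix m assume "m \<in> S"
      then obtain a b where ab: "a < K" "b < L" "m = a + b * t"
        by (auto simp: S_def)
      have "b * t \<le> L * t"
        using ab by simp
      then have "m < p"
        using ab assms(4) by linarith
      then show "m \<in> {..<p}"
        by simp
    qed
  qed (simp add: S_def)
  \<comment> \<open>The coefficient of X^k in (1 + X)^m is \<open>m choose k\<close>, and |S| = K L
    \<le> t guarantees that the block has enough usable coefficients.\<close>
  have "int p dvd l (m mod t, m div t, c)" if "m \<in> S" for m
  proof (rule sparse_binomial_mod[where f = "\<lambda>m. l (m mod t, m div t, c)", OF assms(2) S(1,3) _ that])
    fix k assume "k < card S"
    then have k: "k < t"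
      using S assms(3) by simp
    define T where "T = (\<lambda>(a, b, c'). l (a, b, c') *
      coeff (monom 1 (c' * t) * [:1, 1:] ^ (a + b * t)) (c * t + k))"
    let ?Ic = "{..<K} \<times> {..<L} \<times> {c}"
    have "int p dvd (\<Sum>x\<in>I. T x)"
      using dvd[of "c * t + k"] by (simp add: coeff_sum T_def case_prod_unfold)
    also have "(\<Sum>x\<in>I. T x) = (\<Sum>x\<in>I - ?Ic. T x) + (\<Sum>x\<in>?Ic. T x)"
      using less.prems by (intro sum.subset_diff) (auto simp: I_def)
    finally have "int p dvd (\<Sum>x\<in>I - ?Ic. T x) + (\<Sum>x\<in>?Ic. T x)" .
    moreover have "int p dvd (\<Sum>x\<in>I - ?Ic. T x)"
    proof (intro dvd_sum)
      fix x assume "x \<in> I - ?Ic"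
      then obtain a' b' c' where x: "x = (a', b', c')" "a' < K" "b' < L" "c' < L" "c' \<noteq> c"
        by (cases x) (auto simp: I_def)
      show "int p dvd T x"
      proof (cases "c' < c")
        case True
        then show ?thesis
          using x less.IH[of c' a' b'] by (simp add: T_def)
      next
        case False
        \<comment> \<open>Blocks with c' > c start in degree at least (c + 1) t, beyond c t +
          k.\<close>
        then have "Suc c * t \<le> c' * t"
          using x by (intro mult_le_mono1) auto
        then have "\<not> c' * t \<le> c * t + k"
          using k by simp
        then show ?thesis
          by (simp add: x T_def coeff_monom_mult)
      qed
    qed
    ultimately have "int p dvd (\<Sum>x\<in>?Ic. T x)"
      by (simp add: dvd_add_right_iff)
    also have "(\<Sum>x\<in>?Ic. T x) = (\<Sum>(a, b)\<in>{..<K} \<times> {..<L}. T (a, b, c))"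
      by (rule sum.reindex_bij_witness[of _ "\<lambda>(a, b). (a, b, c)" "\<lambda>(a, b, c). (a, b)"]) auto
    also have "\<dots> = (\<Sum>(a, b)\<in>{..<K} \<times> {..<L}. l (a, b, c) * int ((a + b * t) choose k))"
      using coeff_linear_power_times[of 1]
      by (intro sum.cong) (auto simp: T_def coeff_monom_mult)
    also have "\<dots> = (\<Sum>(a, b)\<in>{..<K} \<times> {..<L}. l ((a + b * t) mod t, (a + b * t) div t, c) *
        int ((a + b * t) choose k))"
      using Kt by (intro sum.cong) auto
    also have "\<dots> = (\<Sum>m\<in>S. l (m mod t, m div t, c) * int (m choose k))"
      unfolding S_def by (subst sum.reindex[OF inj]) (simp add: case_prod_unfold)
    finally show "int p dvd (\<Sum>m\<in>S. l (m mod t, m div t, c) * int (m choose k))" .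
  qed
  moreover have "a + b * t \<in> S"
    using less.prems by (auto simp: S_def)
  ultimately have "int p dvd l ((a + b * t) mod t, (a + b * t) div t, c)"
    by blast
  then show ?case
    using less.prems Kt by simp
qed

text \<open>The auxiliary polynomial is a combination of the K L^2 terms X^(c t) (1 + X)^(a + b t).
  Vanishing to order K at all points of M follows from at most 2 K^2 < K L^2 linear equations common
  to all points. A nontrivial solution gives a polynomial that is nonzero modulo p, of degree at
  most K + 2 L t, with at least |M| K zeros counted with multiplicity.\<close>

lemma stepanov_mod:
  fixes p t K L :: nat and A B :: int
  assumes p: "prime p" and K: "2 * K < L\<^sup>2" and KL: "K * L \<le> t" and deg: "K + L * t \<le> p"
    and AB: "\<not> int p dvd A" "\<not> int p dvd B" and M: "M \<subseteq> {0..<int p}"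
    and My: "\<And>y. y \<in> M \<Longrightarrow> [y ^ t = B] (mod int p)" "\<And>y. y \<in> M \<Longrightarrow> [(1 + y) ^ t = A] (mod int p)"
  shows "card M * K \<le> K + 2 * L * t"
proof (cases "K = 0 \<or> t = 0")
  case False
  define I where "I = {..<K} \<times> {..<L} \<times> {..<L}"
  \<comment> \<open>An equation is indexed by the order k of a Taylor coefficient and by the index
    of a coefficient of \<open>Q\<close>, whose degree is below K + k.\<close>
  define J where "J = (SIGMA k:{..<K}. {..<K + k})"
  \<comment> \<open>This is (y (1 + y))^k times the k-th Taylor coefficient at y of X^(c t) (1 +
    X)^(a + b t), after y^t = B and (1 + y)^t = A are inserted, as a polynomial in y.\<close>
  define Q where "Q = (\<lambda>k (a, b, c). smult (A ^ b * B ^ c)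
    (\<Sum>i\<le>k. smult (int ((a + b * t) choose i) * int ((c * t) choose (k - i)))
      ([:1, 1:] ^ (a + (k - i)) * [:0, 1:] ^ i)))"
  have degQ: "degree (Q k x) < K + k" if xI: "x \<in> I" for k x
  proof -
    obtain a b c where x: "x = (a, b, c)" "a < K"
      using xI by (cases x) (auto simp: I_def)
    have "degree (Q k x) \<le> a + k"
      unfolding Q_def x case_prod_conv
    proof (rule order_trans[OF degree_smult_le], rule degree_sum_le)
      fix i assume "i \<in> {..k}"
      then show "degree (smult (int ((a + b * t) choose i) * int ((c * t) choose (k - i)))
          ([:1, 1:] ^ (a + (k - i)) * [:0, 1:] ^ i)) \<le> a + k"
        by (intro order_trans[OF degree_smult_le] order_trans[OF degree_mult_le])
          (simp add: degree_linear_power)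
    qed simp
    then show ?thesis
      using x by simp
  qed
  have "card J \<le> K * (2 * K)"
  proof -
    have "card J = (\<Sum>k<K. K + k)"
      by (simp add: J_def)
    also have "\<dots> \<le> (\<Sum>k<K. 2 * K)"
      by (intro sum_mono) auto
    finally show ?thesis
      by simp
  qed
  also have "\<dots> < K * L\<^sup>2"
    using K False by simp
  also have "\<dots> = card I"
    by (simp add: I_def power2_eq_square)
  finally have "card J < card I" .
  moreover have "finite I" "finite J"
    by (simp_all add: I_def J_def)
  ultimately obtain l where l: "\<exists>x\<in>I. \<not> int p dvd l x"
    and lJ: "\<And>j. j \<in> J \<Longrightarrow> int p dvd (\<Sum>x\<in>I. coeff (Q (fst j) x) (snd j) * l x)"
    using homogeneous_system_mod[of I J p "\<lambda>x j. coeff (Q (fst j) x) (snd j)"] prime_gt_1_nat[OF p]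
    by blast
  define F where "F = (\<Sum>(a, b, c)\<in>I. smult (l (a, b, c)) (monom 1 (c * t) * [:1, 1:] ^ (a + b * t)))"
  have "dvd_mod (int p) ([:- y, 1:] ^ K) F" if y: "y \<in> M" for y
  proof (rule dvd_mod_linear_power)
    fix k assume k: "k < K"
    have "(y * (1 + y)) ^ k * coeff (pcompose F [:y, 1:]) k =
        (\<Sum>(a, b, c)\<in>I. l (a, b, c) * ((y * (1 + y)) ^ k *
          coeff (pcompose (monom 1 (c * t) * [:1, 1:] ^ (a + b * t)) [:y, 1:]) k))"
      unfolding F_def pcompose_sum coeff_sum sum_distrib_left
      by (intro sum.cong refl) (simp add: case_prod_unfold pcompose_smult)
    also have "[\<dots> = (\<Sum>x\<in>I. l x * poly (Q k x) y)] (mod int p)"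
    proof (intro cong_sum)
      fix x assume "x \<in> I"
      obtain a b c where x: "x = (a, b, c)"
        by (cases x) auto
      have "[(1 + y) ^ (a + b * t + (k - i)) * y ^ (c * t + i) =
          A ^ b * B ^ c * ((1 + y) ^ (a + (k - i)) * y ^ i)] (mod int p)" for i
      proof -
        have "(1 + y) ^ (a + b * t + (k - i)) * y ^ (c * t + i) =
            ((1 + y) ^ t) ^ b * (y ^ t) ^ c * ((1 + y) ^ (a + (k - i)) * y ^ i)"
          by (simp add: power_add power_mult[symmetric] mult_ac)
        also have "[\<dots> = A ^ b * B ^ c * ((1 + y) ^ (a + (k - i)) * y ^ i)] (mod int p)"
          using My y by (intro cong_mult cong_pow cong_refl) auto
        finally show ?thesis .
      qed
      then have "[(\<Sum>i\<le>k. int ((a + b * t) choose i) * int ((c * t) choose (k - i)) *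
            ((1 + y) ^ (a + b * t + (k - i)) * y ^ (c * t + i))) =
          (\<Sum>i\<le>k. int ((a + b * t) choose i) * int ((c * t) choose (k - i)) *
            (A ^ b * B ^ c * ((1 + y) ^ (a + (k - i)) * y ^ i)))] (mod int p)"
        by (intro cong_sum cong_scalar_left)
      also have "(\<Sum>i\<le>k. int ((a + b * t) choose i) * int ((c * t) choose (k - i)) *
            (A ^ b * B ^ c * ((1 + y) ^ (a + (k - i)) * y ^ i))) = poly (Q k x) y"
        unfolding Q_def x case_prod_conv poly_smult poly_sum sum_distrib_left
        by (intro sum.cong) simp_all
      finally show "[(case x of (a, b, c) \<Rightarrow> l (a, b, c) * ((y * (1 + y)) ^ k *
            coeff (pcompose (monom 1 (c * t) * [:1, 1:] ^ (a + b * t)) [:y, 1:]) k)) =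
          l x * poly (Q k x) y] (mod int p)"
        unfolding x case_prod_conv taylor_coeff_monom_times_power
        by (intro cong_scalar_left)
    qed
    also have "(\<Sum>x\<in>I. l x * poly (Q k x) y) =
        (\<Sum>x\<in>I. \<Sum>e<K + k. coeff (Q k x) e * l x * y ^ e)"
    proof (intro sum.cong refl)
      fix x assume "x \<in> I"
      then have "poly (Q k x) y = (\<Sum>e<K + k. coeff (Q k x) e * y ^ e)"
        unfolding poly_altdef using degQ[of x k]
        by (intro sum.mono_neutral_left) (auto simp: coeff_eq_0)
      then show "l x * poly (Q k x) y = (\<Sum>e<K + k. coeff (Q k x) e * l x * y ^ e)"
        by (simp add: sum_distrib_left mult_ac)
    qed
    also have "\<dots> = (\<Sum>e<K + k. (\<Sum>x\<in>I. coeff (Q k x) e * l x) * y ^ e)"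
      by (subst sum.swap) (simp add: sum_distrib_right)
    finally have "[(y * (1 + y)) ^ k * coeff (pcompose F [:y, 1:]) k =
        (\<Sum>e<K + k. (\<Sum>x\<in>I. coeff (Q k x) e * l x) * y ^ e)] (mod int p)" .
    moreover have "int p dvd (\<Sum>e<K + k. (\<Sum>x\<in>I. coeff (Q k x) e * l x) * y ^ e)"
    proof (rule dvd_sum, rule dvd_mult2)
      fix e assume "e \<in> {..<K + k}"
      then show "int p dvd (\<Sum>x\<in>I. coeff (Q k x) e * l x)"
        using lJ[of "(k, e)"] k by (simp add: J_def)
    qed
    ultimately have "int p dvd (y * (1 + y)) ^ k * coeff (pcompose F [:y, 1:]) k"
      using cong_dvd_iff cong_sym by blast
    \<comment> \<open>As t > 0 and the t-th powers B and A are units, the auxiliary factor can be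
      cancelled.\<close>
    moreover have "\<not> int p dvd y" "\<not> int p dvd 1 + y"
      using My[OF y] AB False cong_dvd_iff by (metis dvd_power dvd_trans not_gr_zero)+
    then have "\<not> int p dvd (y * (1 + y)) ^ k"
      using p by (meson prime_dvd_multD prime_dvd_power prime_nat_int_transfer)
    ultimately show "int p dvd coeff (pcompose F [:y, 1:]) k"
      using p by (simp add: prime_dvd_mult_iff)
  qed
  then have dvd: "dvd_mod (int p) (\<Prod>y\<in>M. [:- y, 1:] ^ K) F"
    using M by (intro dvd_mod_prod_linear_power[OF p]) (auto intro: finite_subset)
  have monic: "lead_coeff (\<Prod>y\<in>M. [:- y, 1:] ^ K) = 1"
    by (simp add: lead_coeff_prod lead_coeff_power)
  have "degree (\<Prod>y\<in>M. [:- y, 1:] ^ K) = (\<Sum>y\<in>M. degree ([:- y, 1:] ^ K))"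
    by (intro degree_prod_eq_sum_degree) simp
  then have degM: "degree (\<Prod>y\<in>M. [:- y, 1:] ^ K) = card M * K"
    by (simp add: degree_linear_power)
  have degF: "degree F \<le> K + 2 * L * t"
    unfolding F_def
  proof (intro degree_sum_le)
    fix x assume "x \<in> I"
    then obtain a b c where x: "x = (a, b, c)" "a < K" "b < L" "c < L"
      by (cases x) (auto simp: I_def)
    have "b * t \<le> L * t" "c * t \<le> L * t"
      using x by simp_all
    then have "c * t + (a + b * t) \<le> K + 2 * L * t"
      using x(2) by linarith
    moreover have "degree (monom 1 (c * t) * [:1, 1:] ^ (a + b * t) :: int poly) \<le> c * t + (a + b * t)"
      by (intro order_trans[OF degree_mult_le] add_mono)
        (simp_all add: degree_linear_power degree_monom_le)
    ultimately show "degree (case x of (a, b, c) \<Rightarrow>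
        smult (l (a, b, c)) (monom 1 (c * t) * [:1, 1:] ^ (a + b * t))) \<le> K + 2 * L * t"
      unfolding x case_prod_conv by (meson degree_smult_le order_trans)
  qed (simp add: I_def)
  show ?thesis
  proof (rule ccontr)
    \<comment> \<open>Then F has more zeros than its degree allows and vanishes modulo p, against
      the independence of its terms.\<close>
    assume "\<not> ?thesis"
    then have "int p dvd coeff F e" for e
      using degF degM by (intro dvd_mod_monic_degree_less[OF p dvd monic]) simp
    then have "int p dvd l x" if "x \<in> I" for x
      using independent_mod[OF p KL deg] that unfolding F_def I_def by auto
    then show False
      using l by blast
  qed
qed (use K KL in auto)

text \<open>The parameters are \<open>L \<approx> t\<^sup>1\<^sup>/\<^sup>3\<close> and \<open>K \<approx> L\<^sup>2 / 2\<close>. The hypothesis on \<open>t\<close> ensures \<open>K + L t \<le> p\<close> once \<open>p\<close>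
  exceeds a constant depending on \<open>C\<close>.\<close>

lemma stepanov_bound:
  fixes C :: real
  assumes C: "C > 0"
  shows "\<exists>R\<ge>1. \<forall>(p::nat) (t::nat) (A::int) B M. prime p \<longrightarrow> t \<ge> 1 \<longrightarrow> real t \<le> C * real p powr (2 / 3) \<longrightarrow>
    \<not> int p dvd A \<longrightarrow> \<not> int p dvd B \<longrightarrow> M \<subseteq> {0..<int p} \<longrightarrow>
    (\<forall>y\<in>M. [y ^ t = B] (mod int p) \<and> [(1 + y) ^ t = A] (mod int p)) \<longrightarrow> card M \<le> t \<longrightarrow>
    real (card M) \<le> R * real t powr (2 / 3)"
proof -
  \<comment> \<open>Chosen so that 2 C^(4/3) \<le> p^(1/9) for p > \<open>p0\<close>; smaller p are
    absorbed into the constant.\<close>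
  define p0 where "p0 = (2 * C powr (4 / 3)) powr 9"
  have p0: "p0 \<ge> 0"
    by (simp add: p0_def)
  have "real (card M) \<le> (17 + p0) * real t powr (2 / 3)"
    if p: "prime p" and t: "t \<ge> 1" and tC: "real t \<le> C * real p powr (2 / 3)"
      and AB: "\<not> int p dvd A" "\<not> int p dvd B" and M: "M \<subseteq> {0..<int p}"
      and My: "\<forall>y\<in>M. [y ^ t = B] (mod int p) \<and> [(1 + y) ^ t = A] (mod int p)"
      and Mt: "card M \<le> t"
    for p t :: nat and A B M
  proof -
    define u where "u = real t powr (1 / 3)"
    have u1: "u \<ge> 1"
      unfolding u_def using t by (intro ge_one_powr_ge_zero) auto
    have u3: "u ^ 3 = real t"
      unfolding u_def using t by (simp add: powr_power)
    have u2: "real t powr (2 / 3) = u ^ 2"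
      unfolding u_def using t by (simp add: powr_power)
    have *: "real (card M) \<le> (17 + p0) * u\<^sup>2" if "real (card M) \<le> c" "c \<le> 17 + p0" for c
    proof -
      have "(17 + p0) * 1 \<le> (17 + p0) * u\<^sup>2"
        using p0 u1 by (intro mult_left_mono) auto
      with that show ?thesis
        by (metis mult.right_neutral order_trans)
    qed
    show ?thesis
    proof (cases "real p \<le> p0 \<or> t < 8")
      case True
      then show ?thesis
      proof
        assume "real p \<le> p0"
        moreover have "card M \<le> p"
          using card_mono[OF _ M] by simp
        ultimately show ?thesis
          unfolding u2 using p0 by (intro *[of p0]) auto
      next
        assume "t < 8"
        then show ?thesis
          unfolding u2 using p0 Mt by (intro *[of 8]) auto
      qed
    next
      case False
      then have t8: "t \<ge> 8" and pp0: "real p > p0"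
        by auto
      have u_ge_2: "u \<ge> 2"
      proof (rule ccontr)
        assume "\<not> u \<ge> 2"
        then have "u ^ 3 < 2 ^ 3"
          using u1 by (intro power_strict_mono) auto
        then show False
          using t8 u3 by simp
      qed
      define L where "L = nat \<lfloor>u\<rfloor>"
      \<comment> \<open>The largest K with 2 K < L^2; since L \<ge> 2, it is still at least L^2 /
        4.\<close>
      define K where "K = (L\<^sup>2 - 1) div 2"
      have L: "real L \<le> u" "u < real L + 1" "L \<ge> 2"
        using u_ge_2 by (auto simp: L_def le_nat_iff le_floor_iff)
      have L2: "4 \<le> L\<^sup>2"
        using power_mono[OF L(3), of 2] by simp
      have K: "2 * K < L\<^sup>2" "L\<^sup>2 \<le> 4 * K"
        using L2 unfolding K_def by linarith+
      have "real L ^ 3 \<le> real t"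
        unfolding u3[symmetric] using L by (intro power_mono) auto
      then have L3: "L ^ 3 \<le> t"
        by (simp flip: of_nat_power)
      have "K * L \<le> L\<^sup>2 * L"
        using K by (intro mult_le_mono) auto
      also have "\<dots> \<le> t"
        using L3 by (simp add: power3_eq_cube power2_eq_square)
      finally have KL: "K * L \<le> t" .
      have "K * 2 \<le> K * L"
        using L by (intro mult_le_mono) auto
      moreover have "1 * t \<le> L * t"
        using L by (intro mult_le_mono) auto
      ultimately have "K + L * t \<le> 2 * (L * t)"
        using KL by linarith
      then have "real (K + L * t) \<le> 2 * (real L * real t)"
        by (metis of_nat_le_iff of_nat_mult of_nat_numeral)
      also have "\<dots> \<le> 2 * (u * real t)"
        using L by (intro mult_left_mono mult_right_mono) auto
      also have "u * real t = real t powr (4 / 3)"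
        unfolding u_def using t powr_add[of "real t" "1 / 3" 1] by simp
      also have "\<dots> \<le> (C * real p powr (2 / 3)) powr (4 / 3)"
        using tC by (intro powr_mono2) auto
      also have "\<dots> = C powr (4 / 3) * real p powr (8 / 9)"
        using C by (simp add: powr_mult powr_powr)
      also have "2 * (C powr (4 / 3) * real p powr (8 / 9)) \<le> real p powr (1 / 9) * real p powr (8 / 9)"
      proof -
        have "2 * C powr (4 / 3) = p0 powr (1 / 9)"
          unfolding p0_def powr_powr using C by simp
        also have "\<dots> \<le> real p powr (1 / 9)"
          using pp0 p0 by (intro powr_mono2) auto
        finally show ?thesis
          by (simp add: mult_right_mono flip: mult.assoc)
      qed
      also have "\<dots> = real p"
        using p prime_gt_0_nat[of p] by (simp flip: powr_add)
      finally have deg: "K + L * t \<le> p"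
        by (simp only: of_nat_le_iff)
      have "card M * K \<le> K + 2 * L * t"
        using My by (intro stepanov_mod[OF p K(1) KL deg AB M]) auto
      then have "real (card M) * real K \<le> real K + 2 * real L * real t"
        by (metis of_nat_add of_nat_le_iff of_nat_mult of_nat_numeral)
      \<comment> \<open>Here t = u^3, u < L + 1 \<le> 2 L and L^2 \<le> 4 K, so L t / K is O(u^2),
        which is O(t^(2/3)).\<close>
      moreover have "real L * real t \<le> 4 * real K * (2 * u\<^sup>2)"
      proof -
        have "real L * real t = real L * u * u\<^sup>2"
          by (simp add: u3[symmetric] power3_eq_cube power2_eq_square)
        also have "\<dots> \<le> real L * (2 * real L) * u\<^sup>2"
          using L by (intro mult_right_mono mult_left_mono) auto
        also have "\<dots> = real (L\<^sup>2) * (2 * u\<^sup>2)"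
          by (simp add: power2_eq_square)
        also have "\<dots> \<le> real (4 * K) * (2 * u\<^sup>2)"
          using K by (intro mult_right_mono) (auto simp del: of_nat_power of_nat_mult)
        finally show ?thesis by simp
      qed
      ultimately have "real K * real (card M) \<le> real K * (1 + 16 * u\<^sup>2)"
        by (simp add: algebra_simps)
      moreover have "real K > 0"
        using K L2 by simp
      ultimately have "real (card M) \<le> 1 + 16 * u\<^sup>2"
        by (simp only: mult_le_cancel_left_pos)
      also have "\<dots> \<le> 17 * u\<^sup>2"
        using u1 one_le_power[of u 2] by simp
      also have "\<dots> \<le> (17 + p0) * u\<^sup>2"
        using p0 by (intro mult_right_mono) auto
      finally show ?thesis
        unfolding u2 .
    qed
  qed
  then show ?thesis
    using p0 by (intro exI[of _ "17 + p0"]) auto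
qed

section \<open>Collision counts and sums of greatest common divisors\<close>

lemma card_square_le_card_image_times_collisions:
  assumes "finite X"
  shows "(card X)\<^sup>2 \<le> card (f ` X) * card {(x, y) \<in> X \<times> X. f x = f y}"
proof -
  define c where "c = (\<lambda>z. real (card {x \<in> X. f x = z}))"
  define m where "m = real (card (f ` X))"
  have X: "(\<Sum>z\<in>f ` X. c z) = real (card X)"
    using sum.image_gen[OF assms, of "\<lambda>_. 1::real" f] by (simp add: c_def)
  have "{(x, y) \<in> X \<times> X. f x = f y} = (SIGMA x:X. {y \<in> X. f y = f x})"
    by auto
  then have "real (card {(x, y) \<in> X \<times> X. f x = f y}) = (\<Sum>x\<in>X. c (f x))"
    using assms by (simp add: c_def)
  also have "\<dots> = (\<Sum>z\<in>f ` X. \<Sum>x\<in>{x \<in> X. f x = z}. c (f x))"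
    using sum.image_gen[OF assms] .
  also have "\<dots> = (\<Sum>z\<in>f ` X. \<Sum>x\<in>{x \<in> X. f x = z}. c z)"
    by (intro sum.cong) auto
  also have "\<dots> = (\<Sum>z\<in>f ` X. (c z)\<^sup>2)"
    by (simp add: c_def power2_eq_square)
  finally have E: "real (card {(x, y) \<in> X \<times> X. f x = f y}) = (\<Sum>z\<in>f ` X. (c z)\<^sup>2)" .
  \<comment> \<open>Cauchy-Schwarz in the form that the variance of the fibre sizes is nonnegative,
    scaled by \<open>m\<close> to avoid division.\<close>
  have "0 \<le> (\<Sum>z\<in>f ` X. (m * c z - real (card X))\<^sup>2)"
    by (intro sum_nonneg) auto
  also have "\<dots> = (\<Sum>z\<in>f ` X. m\<^sup>2 * (c z)\<^sup>2 - 2 * m * real (card X) * c z + (real (card X))\<^sup>2)"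
    by (intro sum.cong) (simp_all add: power2_eq_square algebra_simps)
  also have "\<dots> = m\<^sup>2 * (\<Sum>z\<in>f ` X. (c z)\<^sup>2) - 2 * m * real (card X) * (\<Sum>z\<in>f ` X. c z) +
      m * (real (card X))\<^sup>2"
    by (simp add: sum.distrib sum_subtractf sum_distrib_left m_def)
  also have "\<dots> = m * (m * (\<Sum>z\<in>f ` X. (c z)\<^sup>2) - (real (card X))\<^sup>2)"
    unfolding X by (simp add: power2_eq_square algebra_simps)
  finally have *: "0 \<le> m * (m * (\<Sum>z\<in>f ` X. (c z)\<^sup>2) - (real (card X))\<^sup>2)" .
  have "(real (card X))\<^sup>2 \<le> m * (\<Sum>z\<in>f ` X. (c z)\<^sup>2)"
  proof (cases "X = {}")
    case False
    then have "m > 0"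
      using assms by (simp add: m_def card_gt_0_iff)
    then show ?thesis
      using * by (simp add: zero_le_mult_iff)
  qed simp
  then have "real ((card X)\<^sup>2) \<le> real (card (f ` X) * card {(x, y) \<in> X \<times> X. f x = f y})"
    unfolding E[symmetric] m_def by simp
  then show ?thesis
    by (simp only: of_nat_le_iff)
qed

lemma sum_inverse_le_ln: "n \<ge> 1 \<Longrightarrow> (\<Sum>e = 1..n. 1 / real e) \<le> 1 + ln (real n)"
proof (induction n rule: nat_induct_at_least)
  case (Suc n)
  have "ln (1 - 1 / real (Suc n)) \<le> - (1 / real (Suc n))"
    using ln_add_one_self_le_self2[of "- (1 / real (Suc n))"] Suc.hyps by simp
  moreover have "1 - 1 / real (Suc n) = real n / real (Suc n)"
    by (simp add: field_simps)
  ultimately have "1 / real (Suc n) \<le> ln (real (Suc n)) - ln (real n)"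
    using Suc.hyps by (simp add: ln_div)
  then show ?case
    using Suc.IH by simp
qed simp

lemma card_multiples_le:
  assumes "e \<ge> 1"
  shows "real (card {j \<in> {H<..N}. e dvd j}) \<le> real N / real e"
proof -
  have "card {j \<in> {H<..N}. e dvd j} \<le> card {1..N div e}"
  proof (rule card_inj_on_le[where f = "\<lambda>j. j div e"])
    show "inj_on (\<lambda>j. j div e) {j \<in> {H<..N}. e dvd j}"
      by (auto simp: inj_on_def dvd_def)
    show "(\<lambda>j. j div e) ` {j \<in> {H<..N}. e dvd j} \<subseteq> {1..N div e}"
    proof clarsimp
      fix j assume j: "H < j" "j \<le> N" "e dvd j"
      then have "e \<le> j"
        by (intro dvd_imp_le) auto
      then show "Suc 0 \<le> j div e \<and> j div e \<le> N div e"
        using j assms by (simp add: div_le_mono Suc_le_eq div_greater_zero_iff)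
    qed
  qed simp
  then show ?thesis
    using assms by (simp add: le_divide_eq) (metis div_times_less_eq_dividend of_nat_le_iff of_nat_mult
        mult_le_mono1 order_trans)
qed

text \<open>A gcd is at most the sum of all common divisors. After exchanging sums, each e
  contributes e times the squared number of its multiples, at most e (2 H / e)^2, and the harmonic
  sum yields the logarithm.\<close>

lemma sum_gcd_le:
  assumes "H \<ge> 1"
  shows "(\<Sum>j\<in>{H<..2 * H}. \<Sum>j'\<in>{H<..2 * H}. real (gcd j j')) \<le> 4 * (real H)\<^sup>2 * (1 + ln (2 * real H))"
proof -
  define J where "J = {H<..2 * H}"
  define b where "b = (\<lambda>e j::nat. if e dvd j then 1 else 0 :: real)"
  have "real (gcd j j') \<le> (\<Sum>e = 1..2 * H. real e * (b e j * b e j'))" if "j \<in> J" for j j'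
  proof -
    have j: "0 < j" "j \<le> 2 * H"
      using that by (auto simp: J_def)
    then have "gcd j j' \<le> 2 * H"
      by (intro order_trans[OF gcd_le1_nat]) auto
    moreover have "1 \<le> gcd j j'"
      using j by (simp add: Suc_le_eq)
    ultimately have "gcd j j' \<in> {1..2 * H}"
      unfolding atLeastAtMost_iff by blast
    then have "(\<Sum>e\<in>{gcd j j'}. real e * (b e j * b e j')) \<le> (\<Sum>e = 1..2 * H. real e * (b e j * b e j'))"
      by (intro sum_mono2) (auto simp: b_def)
    then show ?thesis
      by (simp add: b_def)
  qed
  then have "(\<Sum>j\<in>J. \<Sum>j'\<in>J. real (gcd j j')) \<le>
      (\<Sum>j\<in>J. \<Sum>j'\<in>J. \<Sum>e = 1..2 * H. real e * (b e j * b e j'))"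
    by (intro sum_mono) auto
  also have "\<dots> = (\<Sum>j\<in>J. \<Sum>e = 1..2 * H. \<Sum>j'\<in>J. real e * (b e j * b e j'))"
    by (rule sum.cong[OF refl]) (rule sum.swap)
  also have "\<dots> = (\<Sum>e = 1..2 * H. \<Sum>j\<in>J. \<Sum>j'\<in>J. real e * (b e j * b e j'))"
    by (rule sum.swap)
  also have "\<dots> = (\<Sum>e = 1..2 * H. real e * (\<Sum>j\<in>J. b e j)\<^sup>2)"
    unfolding power2_eq_square sum_product by (simp only: sum_distrib_left)
  also have "\<dots> \<le> (\<Sum>e = 1..2 * H. 4 * (real H)\<^sup>2 * (1 / real e))"
  proof (rule sum_mono)
    fix e assume e: "e \<in> {1..2 * H}"
    have "(\<Sum>j\<in>J. b e j) = real (card {j \<in> J. e dvd j})"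
      unfolding b_def by (simp add: sum.If_cases J_def Int_def)
    also have "\<dots> \<le> real (2 * H) / real e"
      unfolding J_def using e by (intro card_multiples_le) auto
    finally have "(\<Sum>j\<in>J. b e j)\<^sup>2 \<le> (real (2 * H) / real e)\<^sup>2"
      by (intro power_mono sum_nonneg) (auto simp: b_def)
    then have "real e * (\<Sum>j\<in>J. b e j)\<^sup>2 \<le> real e * (real (2 * H) / real e)\<^sup>2"
      by (intro mult_left_mono) auto
    also have "\<dots> = 4 * (real H)\<^sup>2 * (1 / real e)"
      using e by (simp add: power2_eq_square field_simps)
    finally show "real e * (\<Sum>j\<in>J. b e j)\<^sup>2 \<le> 4 * (real H)\<^sup>2 * (1 / real e)" .
  qed
  also have "\<dots> = 4 * (real H)\<^sup>2 * (\<Sum>e = 1..2 * H. 1 / real e)"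
    by (simp only: sum_distrib_left)
  also have "\<dots> \<le> 4 * (real H)\<^sup>2 * (1 + ln (2 * real H))"
    using sum_inverse_le_ln[of "2 * H"] assms by (intro mult_left_mono) auto
  finally show ?thesis
    unfolding J_def .
qed

subsection \<open>Progressions in subgroups\<close>

text \<open>A proper subgroup as a set of integer representatives. The last two assumptions carry
  Lagrange's theorem: t-th powers are 1, and the index is at least 2.\<close>

locale mod_subgroup =
  fixes p :: nat and G :: "int set"
  assumes prime: "prime p"
    and subset: "G \<subseteq> {1..<int p}"
    and mult_closed: "\<And>x y. x \<in> G \<Longrightarrow> y \<in> G \<Longrightarrow> x * y mod int p \<in> G"
    and inverse: "\<And>x. x \<in> G \<Longrightarrow> \<exists>y\<in>G. [x * y = 1] (mod int p)"
    and power_card: "\<And>x. x \<in> G \<Longrightarrow> [x ^ card G = 1] (mod int p)"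
    and card_less: "2 * card G < p"
begin

lemma finite: "finite G"
  using subset by (rule finite_subset) simp

lemma p_pos: "int p > 0"
  using prime prime_gt_0_nat by simp

lemma not_dvd: "x \<in> G \<Longrightarrow> \<not> int p dvd x"
  using subset zdvd_not_zless by fastforce

lemma eq_if_cong:
  assumes "x \<in> {0..<int p}" "y \<in> {0..<int p}" "[x = y] (mod int p)"
  shows "x = y"
  using assms cong_less_imp_eq_int by auto

lemma mem_bounds: "x \<in> G \<Longrightarrow> x \<in> {0..<int p}"
  using subset by auto

lemma cong_cancel: "\<not> int p dvd c \<Longrightarrow> [c * x = c * y] (mod int p) \<longleftrightarrow> [x = y] (mod int p)"
  using prime prime_imp_coprime[of "int p" c] by (intro cong_mult_lcancel) (simp add: coprime_commute)

lemma cong_mem: "x mod int p \<in> G \<Longrightarrow> [x = y] (mod int p) \<Longrightarrow> y mod int p \<in> G"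
  by (simp add: cong_def)

lemma quotient_mem:
  assumes "x mod int p \<in> G" "y mod int p \<in> G"
  shows "\<exists>g\<in>G. [g * y = x] (mod int p)"
proof -
  obtain z where z: "z \<in> G" "[y mod int p * z = 1] (mod int p)"
    using inverse assms(2) by blast
  then have "[z * y = 1] (mod int p)"
    by (simp add: cong_def mod_simps mult.commute)
  let ?g = "(x mod int p) * z mod int p"
  have "[?g * y = x * (z * y)] (mod int p)"
    by (simp add: cong_def mod_simps mult.assoc)
  also have "[x * (z * y) = x * 1] (mod int p)"
    using \<open>[z * y = 1] (mod int p)\<close> by (intro cong_scalar_left)
  finally show ?thesis
    using mult_closed[OF assms(1) z(1)] by auto
qed

lemma card_translate:
  "card {x \<in> {0..<int p}. (x + c) mod int p \<in> G} = card G"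
proof (rule bij_betw_same_card[of "\<lambda>x. (x + c) mod int p"], rule bij_betw_byWitness[where f' = "\<lambda>y. (y - c) mod int p"])
  show "\<forall>x\<in>{x \<in> {0..<int p}. (x + c) mod int p \<in> G}. ((x + c) mod int p - c) mod int p = x"
    by (simp add: mod_simps)
  show "\<forall>y\<in>G. ((y - c) mod int p + c) mod int p = y"
    using mem_bounds by (simp add: mod_simps)
  show "(\<lambda>y. (y - c) mod int p) ` G \<subseteq> {x \<in> {0..<int p}. (x + c) mod int p \<in> G}"
    using mem_bounds p_pos by (auto simp: mod_simps)
qed auto

text \<open>For u in G these are the g in G for which the progression u, g u, (2 g - 1) u stays in
  G.\<close>

definition consecutive_ratios :: "int set"
  where "consecutive_ratios = {g \<in> G. (2 * g - 1) mod int p \<in> G}"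

end

locale mod_subprogression = mod_subgroup +
  fixes a d :: int and s :: nat
  assumes d: "\<not> int p dvd d"
    and s: "1 \<le> s" "s \<le> p"
    and term_mem: "\<And>j. j < s \<Longrightarrow> (a + int j * d) mod int p \<in> G"
begin

lemma card_pos: "card G > 0"
  using term_mem[of 0] s finite by (auto simp: card_gt_0_iff)

text \<open>The assumptions of \<open>mod_subgroup\<close> allow the empty set; the first term of
  the progression, divided by itself, supplies 1.\<close>

lemma one_mem: "1 \<in> G"
proof -
  obtain g where g: "g \<in> G" "[g * a = a] (mod int p)"
    using quotient_mem[of a a] term_mem[of 0] s by auto
  have "\<not> int p dvd a"
    using term_mem[of 0] s not_dvd by (fastforce simp: dvd_mod_iff)
  then have "[g = 1] (mod int p)"
    using g cong_cancel[of a g 1] by (simp add: mult.commute)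
  then have "g = 1"
    using mem_bounds[OF g(1)] prime_gt_1_nat[OF prime] by (intro eq_if_cong) auto
  then show ?thesis
    using g by simp
qed

text \<open>For \<open>(x, m)\<close> uniform in \<open>{0..<p}\<^sup>2\<close>, the residues \<open>x + m v\<close> with \<open>v < V\<close> are pairwise independent, so
  the number \<open>N\<close> of those in \<open>G\<close> has small variance; but \<open>N = V\<close> for all \<open>(x, m) = (g (a + i d), g d)\<close>
  with \<open>g \<in> G\<close> and \<open>i \<le> s - V\<close>.\<close>

lemma length_square_le: "s\<^sup>2 \<le> 16 * p"
proof -
  \<comment> \<open>Both V and the number s + 1 - V of starting positions are then at least s /
    2.\<close>
  define V where "V = (s + 1) div 2"
  define t where "t = real (card G)"
  define X where "X = {0..<int p}"
  define N where "N = (\<lambda>(x, m). \<Sum>v<V. of_bool ((x + m * int v) mod int p \<in> G) :: real)"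
  have V: "1 \<le> V" "V \<le> s" "s \<le> 2 * V" "s \<le> 2 * (s + 1 - V)"
    using s unfolding V_def by linarith+
  have X: "finite X" "card X = p"
    by (simp_all add: X_def)
  have t: "t > 0" "2 * t \<le> real p"
    using card_pos card_less by (simp_all add: t_def)
  have first: "(\<Sum>x\<in>X. of_bool ((x + c) mod int p \<in> G) :: real) = t" for c
    using card_translate[of c] X by (simp add: t_def X_def Int_def flip: of_bool_def)
  have N1: "(\<Sum>z\<in>X \<times> X. N z) = real V * real p * t"
  proof -
    have "(\<Sum>z\<in>X \<times> X. N z) =
        (\<Sum>v<V. \<Sum>m\<in>X. \<Sum>x\<in>X. of_bool ((x + m * int v) mod int p \<in> G))"
      unfolding N_def sum.cartesian_product[symmetric]
      by (subst sum.swap[of _ "{..<V}"], subst sum.swap[of _ X X], subst sum.swap[of _ X "{..<V}"]) (auto intro: sum.swap)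
    then show ?thesis
      by (simp add: first X)
  qed
  have second: "(\<Sum>(x, m)\<in>X \<times> X. of_bool ((x + m * int v) mod int p \<in> G) *
      of_bool ((x + m * int w) mod int p \<in> G) :: real) \<le> (if v = w then real p * t else 0) + t\<^sup>2"
    if vw: "v < V" "w < V" for v w
  proof (cases "v = w")
    case True
    have "(\<Sum>(x, m)\<in>X \<times> X. of_bool ((x + m * int v) mod int p \<in> G) *
        of_bool ((x + m * int w) mod int p \<in> G) :: real) =
        (\<Sum>m\<in>X. \<Sum>x\<in>X. of_bool ((x + m * int v) mod int p \<in> G))"
      unfolding sum.cartesian_product[symmetric] True by (subst sum.swap) (simp flip: of_bool_conj)
    then show ?thesis
      using True by (simp add: first X)
  next
    case False
    \<comment> \<open>Pairwise independence: v - w is invertible modulo p, so the two residues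
      determine m and then x.\<close>
    let ?f = "\<lambda>(x, m). ((x + m * int v) mod int p, (x + m * int w) mod int p)"
    let ?A = "{(x, m) \<in> X \<times> X. (x + m * int v) mod int p \<in> G \<and> (x + m * int w) mod int p \<in> G}"
    have "card ?A \<le> card (G \<times> G)"
    proof (rule card_inj_on_le[where f = ?f])
      show "inj_on ?f ?A"
      proof (rule inj_onI, clarsimp)
        fix x m y n
        assume *: "x \<in> X" "m \<in> X" "y \<in> X" "n \<in> X"
          and "(x + m * int v) mod int p = (y + n * int v) mod int p"
            "(x + m * int w) mod int p = (y + n * int w) mod int p"
        then have 1: "[x + m * int v = y + n * int v] (mod int p)"
          and 2: "[x + m * int w = y + n * int w] (mod int p)"
          by (simp_all add: cong_def)
        have "\<not> int p dvd int v - int w"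
          using False vw V s dvd_imp_le_int[of "int v - int w" "int p"] by auto
        moreover have "[(int v - int w) * m = (int v - int w) * n] (mod int p)"
          using cong_diff[OF 1 2] by (simp add: algebra_simps)
        ultimately have "m = n"
          using * by (intro eq_if_cong) (simp_all add: X_def cong_cancel)
        with 1 have "x = y"
          using * by (intro eq_if_cong) (simp_all add: X_def cong_add_rcancel)
        then show "x = y \<and> m = n"
          using \<open>m = n\<close> by simp
      qed
    qed (use finite in auto)
    moreover have "(\<Sum>(x, m)\<in>X \<times> X. of_bool ((x + m * int v) mod int p \<in> G) *
        of_bool ((x + m * int w) mod int p \<in> G) :: real) = real (card ?A)"
      using X by (simp add: case_prod_unfold Int_def mem_Times_iff conj_assoc flip: of_bool_conj)
    ultimately show ?thesis
      using False by (simp add: t_def power2_eq_square card_cartesian_product flip: of_nat_mult)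
  qed
  have N2: "(\<Sum>z\<in>X \<times> X. (N z)\<^sup>2) \<le> real V * real p * t + (real V)\<^sup>2 * t\<^sup>2"
  proof -
    have "(\<Sum>z\<in>X \<times> X. (N z)\<^sup>2) = (\<Sum>v<V. \<Sum>w<V. \<Sum>(x, m)\<in>X \<times> X.
        of_bool ((x + m * int v) mod int p \<in> G) * of_bool ((x + m * int w) mod int p \<in> G))"
      unfolding N_def power2_eq_square case_prod_unfold sum_product
      by (subst sum.swap[of _ "{..<V}"], subst sum.swap[of _ "{..<V}" "X \<times> X"]) simp
    also have "\<dots> \<le> (\<Sum>v<V. \<Sum>w<V. (if v = w then real p * t else 0) + t\<^sup>2)"
      using second by (intro sum_mono) auto
    also have "\<dots> = real V * real p * t + (real V)\<^sup>2 * t\<^sup>2"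
      by (simp add: sum.distrib power2_eq_square algebra_simps)
    finally show ?thesis .
  qed
  define Z where "Z = (\<lambda>(g, i). (g * (a + int i * d) mod int p, g * d mod int p)) ` (G \<times> {..<s + 1 - V})"
  have "inj_on (\<lambda>(g, i). (g * (a + int i * d) mod int p, g * d mod int p)) (G \<times> {..<s + 1 - V})"
  proof (rule inj_onI, clarsimp)
    fix g i h j
    assume *: "g \<in> G" "h \<in> G" "i < Suc s - V" "j < Suc s - V"
      and "g * d mod int p = h * d mod int p"
      and eq: "g * (a + int i * d) mod int p = h * (a + int j * d) mod int p"
    then have "[d * g = d * h] (mod int p)"
      by (simp add: cong_def mult.commute)
    then have gh: "g = h"
      using * d by (intro eq_if_cong) (auto simp: cong_cancel dest: mem_bounds)
    have "[d * int i = d * int j] (mod int p)"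
      using eq * not_dvd by (simp add: gh cong_def[symmetric] cong_cancel cong_add_lcancel mult.commute)
    then have "int i = int j"
      using * d s V by (intro eq_if_cong) (auto simp: cong_cancel)
    then show "g = h \<and> i = j"
      using gh by simp
  qed
  then have Z: "real (card Z) = t * real (s + 1 - V)"
    unfolding Z_def by (simp add: card_image t_def card_cartesian_product)
  have ZN: "z \<in> X \<times> X \<and> N z = real V" if zZ: "z \<in> Z" for z
  proof -
    obtain g i where z: "g \<in> G" "i < s + 1 - V" "z = (g * (a + int i * d) mod int p, g * d mod int p)"
      using zZ by (auto simp: Z_def)
    have "(g * (a + int i * d) mod int p + g * d mod int p * int v) mod int p \<in> G" if "v < V" for v
    proof -
      have "i + v < s"
        using z that by linarith
      then have "g * ((a + int (i + v) * d) mod int p) mod int p \<in> G"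
        using z mult_closed term_mem by blast
      moreover have "(g * (a + int i * d) mod int p + g * d mod int p * int v) mod int p =
          (g * (a + int i * d) + g * d * int v) mod int p"
        by (intro mod_add_cong mod_mult_cong) simp_all
      moreover have "g * (a + int i * d) + g * d * int v = g * (a + int (i + v) * d)"
        by (simp add: algebra_simps)
      ultimately show ?thesis
        by (simp only: mod_simps)
    qed
    then have "N z = (\<Sum>v<V. 1)"
      unfolding N_def z(3) case_prod_conv by (intro sum.cong) simp_all
    then show ?thesis
      using z(3) p_pos by (simp add: X_def)
  qed
  \<comment> \<open>Chebyshev's inequality: the mean of N is V t / p, and p N - V t is p times the
    deviation from it. The deviation on \<open>Z\<close> is compared with the whole
    variance.\<close>
  have "t * real (s + 1 - V) * (real p * real V - real V * t)\<^sup>2 = (\<Sum>z\<in>Z. (real p * N z - real V * t)\<^sup>2)"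
    using ZN by (simp add: Z)
  also have "\<dots> \<le> (\<Sum>z\<in>X \<times> X. (real p * N z - real V * t)\<^sup>2)"
    using ZN X by (intro sum_mono2) auto
  also have "\<dots> = (\<Sum>z\<in>X \<times> X. (real p)\<^sup>2 * (N z)\<^sup>2 - 2 * real p * real V * t * N z + (real V)\<^sup>2 * t\<^sup>2)"
    by (intro sum.cong) (simp_all add: power2_eq_square algebra_simps)
  also have "\<dots> = (real p)\<^sup>2 * (\<Sum>z\<in>X \<times> X. (N z)\<^sup>2) - 2 * real p * real V * t * (\<Sum>z\<in>X \<times> X. N z) +
      (real p)\<^sup>2 * ((real V)\<^sup>2 * t\<^sup>2)"
    by (simp add: sum.distrib sum_subtractf sum_distrib_left X power2_eq_square)
  also have "\<dots> \<le> (real p)\<^sup>2 * (real V * real p * t + (real V)\<^sup>2 * t\<^sup>2) -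
      2 * real p * real V * t * (real V * real p * t) + (real p)\<^sup>2 * ((real V)\<^sup>2 * t\<^sup>2)"
    unfolding N1 using t by (intro add_mono diff_mono mult_left_mono N2) auto
  also have "\<dots> = (real p)\<^sup>2 * real V * t * real p"
    by (simp add: power2_eq_square algebra_simps)
  finally have upper: "t * real (s + 1 - V) * (real p * real V - real V * t)\<^sup>2 \<le> (real p)\<^sup>2 * real V * t * real p" .
  \<comment> \<open>Index at least 2 enters here: t \<le> p / 2 keeps the mean of N at most V /
    2.\<close>
  have "real V * real p / 2 \<le> real p * real V - real V * t"
    using mult_left_mono[OF t(2), of "real V"] by (simp add: algebra_simps)
  then have "(real V * real p / 2)\<^sup>2 \<le> (real p * real V - real V * t)\<^sup>2"
    by (intro power_mono) auto
  then have "t * real (s + 1 - V) * (real V * real p / 2)\<^sup>2 \<le> t * real (s + 1 - V) * (real p * real V - real V * t)\<^sup>2"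
    using t by (intro mult_left_mono) auto
  from order_trans[OF this upper]
  have "((real p)\<^sup>2 * real V * t) * (real (s + 1 - V) * real V) \<le> ((real p)\<^sup>2 * real V * t) * (4 * real p)"
    by (simp add: power2_eq_square field_simps)
  then have "real (s + 1 - V) * real V \<le> 4 * real p"
    using t V p_pos by (simp add: mult_le_cancel_left_pos)
  then have "(s + 1 - V) * V \<le> 4 * p"
    by (metis of_nat_le_iff of_nat_mult of_nat_numeral)
  moreover have "s * s \<le> (2 * (s + 1 - V)) * (2 * V)"
    using V by (intro mult_le_mono) auto
  ultimately show ?thesis
    by (simp add: power2_eq_square)
qed

text \<open>Subtracting two solutions gives j (i1' - i2') = j' (i1 - i2) modulo p, and 4 H^2 < p
  makes this an equality of integers. Hence i is determined modulo q = j / gcd j j', and i < H < j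
  leaves at most gcd j j' values for i div q.\<close>

lemma card_equal_ratios_le_gcd:
  assumes j: "H < j" "j \<le> 2 * H" and j': "j' \<le> 2 * H" and H: "4 * H\<^sup>2 < p"
  shows "card {(i, i') \<in> {..<H} \<times> {..<H}. [int j * (a + int i' * d) = int j' * (a + int i * d)] (mod int p)}
    \<le> gcd j j'"
proof -
  let ?A = "{(i, i') \<in> {..<H} \<times> {..<H}. [int j * (a + int i' * d) = int j' * (a + int i * d)] (mod int p)}"
  define g where "g = gcd j j'"
  define q where "q = j div g"
  have jq: "j = q * g" "q > 0" "g > 0"
    using j by (auto simp: q_def g_def div_greater_zero_iff gcd_le1_nat)
  have "card ?A \<le> card {..<g}"
  proof (rule card_inj_on_le[where f = "\<lambda>(i, i'). i div q"])
    show "(\<lambda>(i, i'). i div q) ` ?A \<subseteq> {..<g}"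
      using j jq by (auto simp: less_mult_imp_div_less mult.commute)
    show "inj_on (\<lambda>(i, i'). i div q) ?A"
    proof (rule inj_onI, clarsimp)
      fix i1 i1' i2 i2'
      assume i: "i1 < H" "i1' < H" "i2 < H" "i2' < H"
        and 1: "[int j * (a + int i1' * d) = int j' * (a + int i1 * d)] (mod int p)"
        and 2: "[int j * (a + int i2' * d) = int j' * (a + int i2 * d)] (mod int p)"
        and eq: "i1 div q = i2 div q"
      have "[d * (int j * (int i1' - int i2')) = d * (int j' * (int i1 - int i2))] (mod int p)"
        using cong_diff[OF 1 2] by (simp add: algebra_simps)
      then have dvd: "int p dvd int j * (int i1' - int i2') - int j' * (int i1 - int i2)"
        unfolding cong_cancel[OF d] by (simp add: cong_iff_dvd_diff)
      have b1: "\<bar>int j * (int i1' - int i2')\<bar> \<le> (2 * int H) * int H"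
        unfolding abs_mult using i j by (intro mult_mono) auto
      have b2: "\<bar>int j' * (int i1 - int i2)\<bar> \<le> (2 * int H) * int H"
        unfolding abs_mult using i j' by (intro mult_mono) auto
      have "(2 * int H) * int H + (2 * int H) * int H < int p"
        using H[folded of_nat_less_iff[where 'a = int]] by (simp add: power2_eq_square)
      then have "\<bar>int j * (int i1' - int i2') - int j' * (int i1 - int i2)\<bar> < int p"
        using b1 b2 by linarith
      then have eq': "int j * (int i1' - int i2') = int j' * (int i1 - int i2)"
        using dvd dvd_imp_le_int[of "int j * (int i1' - int i2') - int j' * (int i1 - int i2)" "int p"] by fastforce
      have "coprime q (j' div g)"
        unfolding q_def g_def using j by (intro div_gcd_coprime) auto
      moreover have "j' = (j' div g) * g"
        by (simp add: g_def)
      then have "int q * int g * (int i1' - int i2') = int (j' div g) * int g * (int i1 - int i2)"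
        using eq' jq(1) by (metis of_nat_mult)
      then have "int q * (int i1' - int i2') = int (j' div g) * (int i1 - int i2)"
        using jq(3) by simp
      then have "int q dvd int (j' div g) * (int i1 - int i2)"
        by (metis dvd_triv_left)
      ultimately have "int q dvd int i1 - int i2"
        by (simp add: coprime_dvd_mult_right_iff)
      then have "i1 mod q = i2 mod q"
        by (metis mod_eq_dvd_iff of_nat_eq_iff of_nat_mod)
      then have "i1 = i2"
        using eq by (metis div_mult_mod_eq)
      then show "i1 = i2 \<and> i1' = i2'"
        using eq' j by simp
    qed
  qed simp
  then show ?thesis
    by (simp add: g_def)
qed

text \<open>Send (i, j) with i < H < j \<le> 2 H to the ratio of the terms i + j and i.
  Cauchy-Schwarz bounds the image from below by H^4 over the number of collisions, and the
  collisions are bounded by a sum of gcds.\<close>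

lemma square_le_card_consecutive_ratios:
  assumes H: "1 \<le> H" "5 * H \<le> s" "4 * H\<^sup>2 < p"
  shows "(real H)\<^sup>2 \<le> 4 * real (card consecutive_ratios) * (1 + ln (2 * real H))"
proof -
  define J where "J = {H<..2 * H}"
  define X where "X = {..<H} \<times> J"
  have X: "finite X" "card X = H * H"
    by (simp_all add: X_def J_def)
  have "\<exists>g\<in>consecutive_ratios. [g * (a + int i * d) = a + int (i + j) * d] (mod int p)"
    if "i < H" "j \<in> J" for i j
  proof -
    \<comment> \<open>The largest index i + 2 j is at most (H - 1) + 4 H < s.\<close>
    have m: "(a + int i * d) mod int p \<in> G" "(a + int (i + j) * d) mod int p \<in> G"
        "(a + int (i + 2 * j) * d) mod int p \<in> G"
      using that H by (auto intro!: term_mem simp: J_def simp del: of_nat_add of_nat_mult)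
    obtain g where g: "g \<in> G" "[g * (a + int i * d) = a + int (i + j) * d] (mod int p)"
      using quotient_mem[OF m(2,1)] by blast
    obtain h where h: "h \<in> G" "[h * (a + int i * d) = a + int (i + 2 * j) * d] (mod int p)"
      using quotient_mem[OF m(3,1)] by blast
    have "[2 * (g * (a + int i * d)) - (a + int i * d) =
        2 * (a + int (i + j) * d) - (a + int i * d)] (mod int p)"
      by (intro cong_diff cong_scalar_left g cong_refl)
    also have "2 * (a + int (i + j) * d) - (a + int i * d) = a + int (i + 2 * j) * d"
      by (simp add: algebra_simps)
    also have "[a + int (i + 2 * j) * d = h * (a + int i * d)] (mod int p)"
      using h by (simp add: cong_sym)
    finally have "[(a + int i * d) * (2 * g - 1) = (a + int i * d) * h] (mod int p)"
      by (simp add: algebra_simps)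
    moreover have "\<not> int p dvd a + int i * d"
      using not_dvd[OF m(1)] by (simp add: dvd_mod_iff)
    ultimately have "[h = 2 * g - 1] (mod int p)"
      by (simp add: cong_cancel cong_sym)
    moreover have "h mod int p \<in> G"
      using h(1) mem_bounds by fastforce
    ultimately have "(2 * g - 1) mod int p \<in> G"
      by (rule cong_mem[rotated])
    then show ?thesis
      using g by (auto simp: consecutive_ratios_def)
  qed
  then have "\<forall>x\<in>X. \<exists>g. g \<in> consecutive_ratios \<and> [g * (a + int (fst x) * d) = a + int (fst x + snd x) * d] (mod int p)"
    by (fastforce simp: X_def)
  then obtain f where f: "\<And>x. x \<in> X \<Longrightarrow> f x \<in> consecutive_ratios"
    "\<And>x. x \<in> X \<Longrightarrow> [f x * (a + int (fst x) * d) = a + int (fst x + snd x) * d] (mod int p)"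
    by (metis bchoice)
  let ?P = "{(x, y) \<in> X \<times> X. f x = f y}"
  let ?S = "\<lambda>j j'. {(i, i') \<in> {..<H} \<times> {..<H}. [int j * (a + int i' * d) = int j' * (a + int i * d)] (mod int p)}"
  have S: "finite (?S j j')" for j j'
    by (rule finite_subset[of _ "{..<H} \<times> {..<H}"]) auto
  have J: "finite J"
    by (simp add: J_def)
  have "?P \<subseteq> (\<Union>(j, j')\<in>J \<times> J. (\<lambda>(i, i'). ((i, j), (i', j'))) ` ?S j j')"
  proof clarify
    fix i j i' j'
    assume ij: "(i, j) \<in> X" "(i', j') \<in> X" and eq: "f (i, j) = f (i', j')"
    define g where "g = f (i, j)"
    define u where "u = a + int i * d"
    define u' where "u' = a + int i' * d"
    have "[g * u - u = d * int j] (mod int p)"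
      using cong_diff[OF f(2)[OF ij(1)] cong_refl[of "a + int i * d"]]
      by (simp add: g_def u_def algebra_simps)
    then have 1: "[(g * u - u) * u' = d * int j * u'] (mod int p)"
      by (intro cong_scalar_right)
    have "[g * u' - u' = d * int j'] (mod int p)"
      using cong_diff[OF f(2)[OF ij(2)] cong_refl[of "a + int i' * d"]]
      by (simp add: g_def eq u'_def algebra_simps)
    then have 2: "[(g * u' - u') * u = d * int j' * u] (mod int p)"
      by (intro cong_scalar_right)
    \<comment> \<open>Both sides equal (g - 1) u u'; eliminating the common ratio g leaves the
      relation j u' = j' u.\<close>
    have "(g * u - u) * u' = (g * u' - u') * u"
      by (simp add: algebra_simps)
    then have "[d * (int j * u') = d * (int j' * u)] (mod int p)"
      using cong_trans[OF cong_sym[OF 1]] 2 by (simp add: mult.assoc)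
    then have "[int j * u' = int j' * u] (mod int p)"
      using d by (simp add: cong_cancel)
    then show "((i, j), (i', j')) \<in> (\<Union>(j, j')\<in>J \<times> J. (\<lambda>(i, i'). ((i, j), (i', j'))) ` ?S j j')"
      using ij unfolding X_def u_def u'_def
      by (intro UN_I[of "(j, j')"]) (auto intro!: image_eqI[of _ _ "(i, i')"])
  qed
  then have "card ?P \<le> card (\<Union>(j, j')\<in>J \<times> J. (\<lambda>(i, i'). ((i, j), (i', j'))) ` ?S j j')"
    using J S by (intro card_mono finite_UN_I) auto
  also have "\<dots> \<le> (\<Sum>jj\<in>J \<times> J. card (case jj of (j, j') \<Rightarrow> (\<lambda>(i, i'). ((i, j), (i', j'))) ` ?S j j'))"
    using J by (intro card_UN_le) simp
  also have "\<dots> \<le> (\<Sum>(j, j')\<in>J \<times> J. gcd j j')"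
  proof (rule sum_mono)
    fix jj assume "jj \<in> J \<times> J"
    then obtain j j' where jj: "jj = (j, j')" "j \<in> J" "j' \<in> J"
      by blast
    have "card ((\<lambda>(i, i'). ((i, j), (i', j'))) ` ?S j j') \<le> card (?S j j')"
      by (intro card_image_le S)
    also have "\<dots> \<le> gcd j j'"
      using jj H by (intro card_equal_ratios_le_gcd) (auto simp: J_def)
    finally show "card (case jj of (j, j') \<Rightarrow> (\<lambda>(i, i'). ((i, j), (i', j'))) ` ?S j j') \<le>
        (case jj of (j, j') \<Rightarrow> gcd j j')"
      unfolding jj(1) case_prod_conv .
  qed
  finally have "card ?P \<le> (\<Sum>(j, j')\<in>J \<times> J. gcd j j')" .
  then have "real (card ?P) \<le> real (\<Sum>(j, j')\<in>J \<times> J. gcd j j')"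
    by (simp only: of_nat_le_iff)
  also have "\<dots> = (\<Sum>j\<in>J. \<Sum>j'\<in>J. real (gcd j j'))"
    by (simp add: sum.cartesian_product case_prod_unfold)
  also have "\<dots> \<le> 4 * (real H)\<^sup>2 * (1 + ln (2 * real H))"
    unfolding J_def by (rule sum_gcd_le[OF H(1)])
  finally have P: "real (card ?P) \<le> 4 * (real H)\<^sup>2 * (1 + ln (2 * real H))" .
  have "f ` X \<subseteq> consecutive_ratios"
    using f by blast
  then have "card (f ` X) \<le> card consecutive_ratios"
    by (intro card_mono) (auto simp: consecutive_ratios_def intro: finite_subset[OF _ finite])
  then have fX: "real (card (f ` X)) \<le> real (card consecutive_ratios)"
    by simp
  have "(real H)\<^sup>2 * (real H)\<^sup>2 = real ((card X)\<^sup>2)"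
    by (simp add: X power2_eq_square)
  also have "\<dots> \<le> real (card (f ` X) * card ?P)"
    using card_square_le_card_image_times_collisions[OF X(1), of f] by (simp only: of_nat_le_iff)
  also have "\<dots> = real (card (f ` X)) * real (card ?P)"
    by simp
  also have "\<dots> \<le> real (card consecutive_ratios) * (4 * (real H)\<^sup>2 * (1 + ln (2 * real H)))"
    using fX P by (intro mult_mono) auto
  also have "\<dots> = (real H)\<^sup>2 * (4 * real (card consecutive_ratios) * (1 + ln (2 * real H)))"
    by simp
  finally show ?thesis
    using H(1) by (elim mult_left_le_imp_le) simp
qed

lemma length_square_le_consecutive_ratios:
  "(real s)\<^sup>2 \<le> 1600 * real (card consecutive_ratios) * (1 + ln (real s))"
proof (cases "s < 10")
  case True
  have "1 \<in> consecutive_ratios"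
    using one_mem prime_gt_1_nat[OF prime] by (simp add: consecutive_ratios_def)
  moreover have "finite consecutive_ratios"
    using finite by (simp add: consecutive_ratios_def)
  ultimately have "card consecutive_ratios \<ge> 1"
    by (metis One_nat_def Suc_leI card_gt_0_iff empty_iff)
  moreover have "1 + ln (real s) \<ge> 1"
    using s by simp
  ultimately have "1600 * real (card consecutive_ratios) * (1 + ln (real s)) \<ge> 1600 * 1 * 1"
    by (intro mult_mono) auto
  moreover have "(real s)\<^sup>2 \<le> 10\<^sup>2"
    using True by (intro power_mono) auto
  ultimately show ?thesis
    by simp
next
  case False
  \<comment> \<open>With s^2 \<le> 16 p this gives 100 H^2 \<le> 16 p, enough for 4 H^2 < p; s \<ge>
    10 keeps s \<le> 20 H.\<close>
  define H where "H = s div 10"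
  have H: "1 \<le> H" "10 * H \<le> s" "s \<le> 20 * H"
    using False unfolding H_def by presburger+
  have "(10 * H)\<^sup>2 \<le> s\<^sup>2"
    using H by (intro power_mono) auto
  then have "100 * H\<^sup>2 \<le> 16 * p"
    using length_square_le by (simp add: power_mult_distrib)
  then have Hp: "4 * H\<^sup>2 < p"
    using p_pos by linarith
  have "(real s)\<^sup>2 \<le> (20 * real H)\<^sup>2"
    using H by (intro power_mono) auto
  also have "\<dots> = 400 * (real H)\<^sup>2"
    by (simp add: power_mult_distrib)
  also have "\<dots> \<le> 400 * (4 * real (card consecutive_ratios) * (1 + ln (2 * real H)))"
    using square_le_card_consecutive_ratios[OF H(1) _ Hp] H by simp
  also have "\<dots> \<le> 400 * (4 * real (card consecutive_ratios) * (1 + ln (real s)))"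
    using H by (intro mult_left_mono add_mono) auto
  finally show ?thesis
    by simp
qed

end

section \<open>Linear equations in subgroups reduced to Stepanov's bound\<close>

context mod_subgroup
begin

text \<open>Put y = -2 g. Then 1 + y = -(2 g - 1), so the t-th powers of y and 1 + y are the
  constants (-2)^t and (-1)^t. The assumption \<open>Q\<close> stands for Stepanov's bound at t =
  |G|.\<close>

lemma card_consecutive_ratios_le:
  assumes Q: "\<And>A B M. \<not> int p dvd A \<Longrightarrow> \<not> int p dvd B \<Longrightarrow> M \<subseteq> {0..<int p} \<Longrightarrow>
    (\<forall>y\<in>M. [y ^ card G = B] (mod int p) \<and> [(1 + y) ^ card G = A] (mod int p)) \<Longrightarrow>
    card M \<le> card G \<Longrightarrow> real (card M) \<le> Q"
  shows "real (card consecutive_ratios) \<le> Q"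
proof (cases "G = {}")
  case True
  have "real (card ({} :: int set)) \<le> Q"
    using prime by (intro Q[of 1 1]) (auto simp: not_prime_unit)
  then show ?thesis
    unfolding consecutive_ratios_def using True by simp
next
  case False
  then have "card G > 0"
    using finite by (simp add: card_gt_0_iff)
  then have "p > 2"
    using card_less by linarith
  then have "\<not> int p dvd 2"
    using zdvd_not_zless[of 2 "int p"] by simp
  then have two: "\<not> int p dvd - 2"
    by simp
  let ?f = "\<lambda>g. (- 2 * g) mod int p"
  have inj: "inj_on ?f consecutive_ratios"
  proof (rule inj_onI)
    fix g h assume *: "g \<in> consecutive_ratios" "h \<in> consecutive_ratios" "?f g = ?f h"
    then have "[g = h] (mod int p)"
      using cong_cancel[OF two] by (simp add: cong_def)
    then show "g = h"
      using * by (intro eq_if_cong mem_bounds) (auto simp: consecutive_ratios_def)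
  qed
  have "real (card (?f ` consecutive_ratios)) \<le> Q"
  proof (rule Q[of "(- 1) ^ card G" "(- 2) ^ card G"])
    show "\<not> int p dvd (- 2) ^ card G"
      using two prime by (meson prime_dvd_power prime_nat_int_transfer)
    show "\<not> int p dvd (- 1) ^ card G"
      using prime by (meson not_prime_unit dvd_trans minus_one_power_iff prime_dvd_power
          prime_nat_int_transfer dvd_minus_iff)
    show "?f ` consecutive_ratios \<subseteq> {0..<int p}"
      using p_pos by auto
    show "card (?f ` consecutive_ratios) \<le> card G"
      using finite by (intro order_trans[OF card_image_le] card_mono)
        (auto simp: consecutive_ratios_def)
    show "\<forall>y\<in>?f ` consecutive_ratios. [y ^ card G = (- 2) ^ card G] (mod int p) \<and>
        [(1 + y) ^ card G = (- 1) ^ card G] (mod int p)"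
    proof (intro ballI conjI; elim imageE)
      fix y g assume g: "g \<in> consecutive_ratios" and y: "y = ?f g"
      have "[y = - 2 * g] (mod int p)"
        by (simp add: y cong_def)
      then have "[y ^ card G = (- 2) ^ card G * g ^ card G] (mod int p)"
        using cong_pow power_mult_distrib by metis
      also have "[(- 2) ^ card G * g ^ card G = (- 2) ^ card G * 1] (mod int p)"
        using g by (intro cong_scalar_left power_card) (simp add: consecutive_ratios_def)
      finally show "[y ^ card G = (- 2) ^ card G] (mod int p)"
        by simp
    next
      fix y g assume g: "g \<in> consecutive_ratios" and y: "y = ?f g"
      let ?h = "(2 * g - 1) mod int p"
      have "[1 + y = 1 + - 2 * g] (mod int p)"
        by (intro cong_add cong_refl) (simp add: y cong_def)
      also have "1 + - 2 * g = - 1 * (2 * g - 1)"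
        by simp
      also have "[- 1 * (2 * g - 1) = - 1 * ?h] (mod int p)"
        by (intro cong_scalar_left) (simp add: cong_def)
      finally have "[(1 + y) ^ card G = (- 1) ^ card G * ?h ^ card G] (mod int p)"
        using cong_pow power_mult_distrib by metis
      also have "[(- 1) ^ card G * ?h ^ card G = (- 1) ^ card G * 1] (mod int p)"
        using g by (intro cong_scalar_left power_card) (simp add: consecutive_ratios_def)
      finally show "[(1 + y) ^ card G = (- 1) ^ card G] (mod int p)"
        by simp
    qed
  qed
  then show ?thesis
    by (simp only: card_image[OF inj])
qed

text \<open>Dividing h = g + x by x gives y = g / x and 1 + y = h / x, both with t-th power e^t for
  the inverse e of x. The first coordinate determines the pair.\<close>

lemma card_differences_le:
  assumes x: "\<not> int p dvd x"
    and Q: "\<And>A B M. \<not> int p dvd A \<Longrightarrow> \<not> int p dvd B \<Longrightarrow> M \<subseteq> {0..<int p} \<Longrightarrow>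
    (\<forall>y\<in>M. [y ^ card G = B] (mod int p) \<and> [(1 + y) ^ card G = A] (mod int p)) \<Longrightarrow>
    card M \<le> card G \<Longrightarrow> real (card M) \<le> Q"
  shows "real (card {(g, h) \<in> G \<times> G. [h = g + x] (mod int p)}) \<le> Q"
proof -
  let ?D = "{(g, h) \<in> G \<times> G. [h = g + x] (mod int p)}"
  have "coprime x (int p)"
    using prime_imp_coprime[of "int p" x] x prime by (simp add: coprime_commute)
  then obtain e where e: "[x * e = 1] (mod int p)"
    using cong_solve_coprime_int by blast
  then have e_unit: "\<not> int p dvd e"
    using prime by (metis cong_dvd_iff dvd_mult not_prime_unit prime_nat_int_transfer)
  let ?f = "\<lambda>g. (e * g) mod int p"
  have inj_fst: "inj_on fst ?D"
  proof (rule inj_onI, clarsimp)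
    fix g h h' assume *: "h \<in> G" "h' \<in> G" "[h = g + x] (mod int p)" "[h' = g + x] (mod int p)"
    then have "[h = h'] (mod int p)"
      using cong_sym cong_trans by blast
    then show "h = h'"
      using * by (intro eq_if_cong mem_bounds) auto
  qed
  have D: "fst ` ?D \<subseteq> G"
    by auto
  have inj: "inj_on ?f (fst ` ?D)"
  proof (rule inj_onI)
    fix g h assume *: "g \<in> fst ` ?D" "h \<in> fst ` ?D" "?f g = ?f h"
    then have "[g = h] (mod int p)"
      using cong_cancel[OF e_unit] by (simp add: cong_def)
    then show "g = h"
      using * D by (intro eq_if_cong mem_bounds) auto
  qed
  have "real (card (?f ` fst ` ?D)) \<le> Q"
  proof (rule Q[of "e ^ card G" "e ^ card G"])
    show "\<not> int p dvd e ^ card G" "\<not> int p dvd e ^ card G"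
      using e_unit prime by (meson prime_dvd_power prime_nat_int_transfer)+
    show "?f ` fst ` ?D \<subseteq> {0..<int p}"
      using p_pos by auto
    show "card (?f ` fst ` ?D) \<le> card G"
      using card_image[OF inj] card_mono[OF finite D] by simp
    have pow: "[y ^ card G = e ^ card G] (mod int p)" if "[y = e * g] (mod int p)" "g \<in> G" for y g
    proof -
      have "[y ^ card G = e ^ card G * g ^ card G] (mod int p)"
        using that(1) cong_pow power_mult_distrib by metis
      also have "[e ^ card G * g ^ card G = e ^ card G * 1] (mod int p)"
        using that(2) by (intro cong_scalar_left power_card)
      finally show ?thesis
        by simp
    qed
    show "\<forall>y\<in>?f ` fst ` ?D. [y ^ card G = e ^ card G] (mod int p) \<and>
        [(1 + y) ^ card G = e ^ card G] (mod int p)"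
    proof (intro ballI)
      fix y assume "y \<in> ?f ` fst ` ?D"
      then obtain g h where gh: "g \<in> G" "h \<in> G" "[h = g + x] (mod int p)" and y: "y = ?f g"
        by auto
      have y': "[y = e * g] (mod int p)"
        by (simp add: y cong_def)
      have "[1 + y = x * e + e * g] (mod int p)"
        using e y' by (intro cong_add) (auto intro: cong_sym)
      also have "x * e + e * g = e * (g + x)"
        by (simp add: algebra_simps)
      also have "[e * (g + x) = e * h] (mod int p)"
        using gh by (intro cong_scalar_left) (auto intro: cong_sym)
      finally show "[y ^ card G = e ^ card G] (mod int p) \<and>
          [(1 + y) ^ card G = e ^ card G] (mod int p)"
        using pow[OF _ gh(2)] pow[OF y' gh(1)] by blast
    qed
  qed
  then show ?thesis
    by (simp only: card_image[OF inj] card_image[OF inj_fst])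
qed

end

subsection \<open>Energies\<close>

lemma residue_ring_minus:
  assumes "1 < p"
  shows "x \<ominus>\<^bsub>Fp p\<^esub> y = (x - y) mod int p"
proof -
  interpret residues "int p" "Fp p"
    using assms by unfold_locales auto
  show ?thesis
    by (simp add: a_minus_def res_neg_eq res_add_eq mod_simps)
qed

lemma residue_ring_add_pow:
  assumes "1 < p"
  shows "[(n::nat)] \<cdot>\<^bsub>Fp p\<^esub> x = (int n * x) mod int p"
proof -
  interpret residues "int p" "Fp p"
    using assms by unfold_locales auto
  show ?thesis
    by (induction n) (simp_all add: add_pow_def nat_pow_def res_add_eq res_zero_eq mod_simps algebra_simps)
qed

lemma mod_subgroup_if_proper_mult_subgroup:
  assumes p: "prime p" and "proper_mult_subgroup p G"
  shows "mod_subgroup p G"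
proof -
  interpret residues_prime p "Fp p"
    using p by unfold_locales (auto simp: prime_gt_1_nat)
  have G: "subgroup G (mult_of (Fp p))" "G \<noteq> carrier (mult_of (Fp p))"
    using assms(2) by (auto simp: proper_mult_subgroup_def)
  interpret M: group "mult_of (Fp p)"
    by (rule field_mult_group)
  interpret G: subgroup G "mult_of (Fp p)"
    by (rule G(1))
  have carrier: "carrier (mult_of (Fp p)) = {1..<int p}"
    by (auto simp: res_carrier_eq res_zero_eq)
  have subset: "G \<subseteq> {1..<int p}"
    using G.subset carrier by simp
  have pow: "x [^]\<^bsub>mult_of (Fp p)\<^esub> (n::nat) = x ^ n mod int p" if "x \<in> G" for x n
    using pow_cong[of x n] subset that by (auto simp: nat_pow_mult_of)
  show ?thesis
  proof
    show "prime p" "G \<subseteq> {1..<int p}"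
      by fact+
    show "x * y mod int p \<in> G" if "x \<in> G" "y \<in> G" for x y
      using G.m_closed[OF that] by (simp add: res_mult_eq)
    show "\<exists>y\<in>G. [x * y = 1] (mod int p)" if "x \<in> G" for x
    proof
      show "inv\<^bsub>mult_of (Fp p)\<^esub> x \<in> G"
        by (rule G.m_inv_closed[OF that])
      have "x \<otimes>\<^bsub>mult_of (Fp p)\<^esub> inv\<^bsub>mult_of (Fp p)\<^esub> x = \<one>\<^bsub>mult_of (Fp p)\<^esub>"
        using G.mem_carrier[OF that] by (rule M.r_inv)
      then show "[x * inv\<^bsub>mult_of (Fp p)\<^esub> x = 1] (mod int p)"
        using prime_gt_1_nat[OF p] by (simp add: res_mult_eq res_one_eq cong_def)
    qed
    show "[x ^ card G = 1] (mod int p)" if "x \<in> G" for x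
    proof -
      interpret H: group "(mult_of (Fp p))\<lparr>carrier := G\<rparr>"
        by (rule G.subgroup_is_group[OF M.group_axioms])
      have "x [^]\<^bsub>(mult_of (Fp p))\<lparr>carrier := G\<rparr>\<^esub> card G = \<one>\<^bsub>mult_of (Fp p)\<^esub>"
        using H.pow_order_eq_1[of x] that by (simp add: Coset.order_def)
      then have "x [^]\<^bsub>mult_of (Fp p)\<^esub> card G = \<one>\<^bsub>mult_of (Fp p)\<^esub>"
        using M.nat_pow_consistent[of x "card G" G] by simp
      then show ?thesis
        using pow[OF that] prime_gt_1_nat[OF p] by (simp add: res_one_eq cong_def)
    qed
    show "2 * card G < p"
    proof -
      have card: "card (carrier (mult_of (Fp p))) = p - 1"
        unfolding carrier by simp
      have "card G dvd p - 1"
        using M.lagrange[OF G(1)] card by (metis dvd_triv_right Coset.order_def)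
      then obtain k where k: "p - 1 = card G * k"
        by (auto simp: dvd_def)
      moreover have "card G < p - 1"
        using G card psubset_card_mono[of "carrier (mult_of (Fp p))" G] G.subset carrier by auto
      \<comment> \<open>The index k divides out p - 1 = |G| k; properness excludes k = 1.\<close>
      ultimately have "k \<ge> 2"
        by (cases k rule: nat.exhaust; cases "k = 1") auto
      then have "card G * 2 \<le> p - 1"
        unfolding k by (intro mult_le_mono) auto
      then show ?thesis
        using prime_gt_0_nat[OF p] by linarith
    qed
  qed
qed

lemma mod_subprogression_if_arith_progression:
  assumes "prime p" "proper_mult_subgroup p G" "arith_progression p P" "P \<subseteq> G"
  shows "\<exists>a d. mod_subprogression p G a d (card P)"
proof -
  interpret mod_subgroup p G
    using assms by (intro mod_subgroup_if_proper_mult_subgroup)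
  have p1: "1 < p"
    using prime prime_gt_1_nat by blast
  interpret residues "int p" "Fp p"
    using p1 by unfold_locales auto
  obtain a d s where ad: "d \<in> carrier (Fp p) - {\<zero>\<^bsub>Fp p\<^esub>}" and s: "1 \<le> s" "s \<le> p"
    and P: "P = {a \<oplus>\<^bsub>Fp p\<^esub> [j] \<cdot>\<^bsub>Fp p\<^esub> d | j::nat. j < s}"
    using assms(3) by (auto simp: arith_progression_def)
  have d: "\<not> int p dvd d"
    using ad zdvd_not_zless[of d "int p"] by (auto simp: res_carrier_eq res_zero_eq)
  have P': "P = (\<lambda>j. (a + int j * d) mod int p) ` {..<s}"
    unfolding P residue_ring_add_pow[OF p1] res_add_eq by (auto simp: mod_simps)
  have "inj_on (\<lambda>j. (a + int j * d) mod int p) {..<s}"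
  proof (rule inj_onI)
    fix i j assume *: "i \<in> {..<s}" "j \<in> {..<s}" "(a + int i * d) mod int p = (a + int j * d) mod int p"
    then have "[d * int i = d * int j] (mod int p)"
      by (simp add: cong_def[symmetric] cong_add_lcancel mult.commute)
    then have "int i = int j"
      using * s by (intro eq_if_cong) (auto simp: cong_cancel[OF d])
    then show "i = j"
      by simp
  qed
  then have "card P = s"
    unfolding P' by (simp add: card_image)
  then have "mod_subprogression p G a d (card P)"
    using d s assms(4) by unfold_locales (auto simp: P')
  then show ?thesis
    by blast
qed

section \<open>Difference counts and the splitting of energies\<close>

lemma diff_count_eq:
  assumes "1 < p" "0 \<le> x" "x < int p"
  shows "diff_count p A x = card {(a, b) \<in> A \<times> A. [b = a + x] (mod int p)}"
proof -
  have "(b - a) mod int p = x \<longleftrightarrow> [b = a + x] (mod int p)" for a b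
  proof -
    have "(b - a) mod int p = x \<longleftrightarrow> [b - a = x] (mod int p)"
      using assms by (simp add: cong_def)
    also have "\<dots> \<longleftrightarrow> [b = a + x] (mod int p)"
      by (simp add: cong_iff_dvd_diff algebra_simps)
    finally show ?thesis .
  qed
  then show ?thesis
    unfolding diff_count_def residue_ring_minus[OF assms(1)] by (simp add: case_prod_unfold mem_Times_iff conj_assoc)
qed

lemma diff_count_le_card:
  assumes "1 < p" "A \<subseteq> {0..<int p}" "0 \<le> x" "x < int p"
  shows "diff_count p A x \<le> card A"
  unfolding diff_count_eq[OF assms(1,3,4)]
proof (rule card_inj_on_le[where f = fst])
  show "inj_on fst {(a, b) \<in> A \<times> A. [b = a + x] (mod int p)}"
  proof (rule inj_onI, clarsimp)
    fix a b c assume *: "b \<in> A" "c \<in> A" "[b = a + x] (mod int p)" "[c = a + x] (mod int p)"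
    then have "[b = c] (mod int p)"
      using cong_sym cong_trans by blast
    then show "b = c"
      using subsetD[OF assms(2) *(1)] subsetD[OF assms(2) *(2)] cong_less_imp_eq_int[of b "int p" c] by auto
  qed
qed (use assms(2) in \<open>auto intro: finite_subset\<close>)

lemma sum_diff_count:
  assumes "1 < p" "finite A"
  shows "(\<Sum>x\<in>{0..<int p}. diff_count p A x) = (card A)\<^sup>2"
proof -
  have "diff_count p A x = (\<Sum>z\<in>{z \<in> A \<times> A. (snd z - fst z) mod int p = x}. 1)" for x
    unfolding diff_count_def residue_ring_minus[OF assms(1)]
    by (simp add: case_prod_unfold mem_Times_iff conj_assoc)
  then have "(\<Sum>x\<in>{0..<int p}. diff_count p A x) =
      (\<Sum>x\<in>{0..<int p}. \<Sum>z\<in>{z \<in> A \<times> A. (snd z - fst z) mod int p = x}. 1)"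
    by simp
  also have "\<dots> = (\<Sum>z\<in>A \<times> A. 1)"
    using assms by (intro sum.group) auto
  finally show ?thesis
    by (simp add: power2_eq_square card_cartesian_product)
qed

text \<open>At x = 0 both counts are at most the cardinalities. Elsewhere the power is at most
  R^(l-1), and the counts for A sum to at most |A|^2.\<close>

lemma higher_energy_le:
  assumes p: "1 < p" and AB: "A \<subseteq> {0..<int p}" "B \<subseteq> {0..<int p}" and R: "R \<ge> 0"
    and le: "\<And>x. 0 < x \<Longrightarrow> x < int p \<Longrightarrow> real (diff_count p B x) \<le> R"
  shows "real (higher_energy p l A B) \<le> real (card A) * real (card B) ^ (l - 1) + (real (card A))\<^sup>2 * R ^ (l - 1)"
proof -
  interpret residues "int p" "Fp p"
    using p by unfold_locales auto
  have carrier: "carrier (Fp p) = {0..<int p}"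
    by (auto simp: res_carrier_eq)
  let ?f = "\<lambda>x. real (diff_count p A x) * real (diff_count p B x) ^ (l - 1)"
  have "real (higher_energy p l A B) = ?f 0 + (\<Sum>x\<in>{0..<int p} - {0}. ?f x)"
    unfolding higher_energy_def carrier using p by (simp add: sum.remove[of _ 0])
  also have "?f 0 \<le> real (card A) * real (card B) ^ (l - 1)"
    using diff_count_le_card[OF p AB(1), of 0] diff_count_le_card[OF p AB(2), of 0] p
    by (intro mult_mono power_mono) auto
  also have "(\<Sum>x\<in>{0..<int p} - {0}. ?f x) \<le> (\<Sum>x\<in>{0..<int p} - {0}. real (diff_count p A x) * R ^ (l - 1))"
    using le by (intro sum_mono mult_left_mono power_mono) auto
  also have "\<dots> \<le> (\<Sum>x\<in>{0..<int p}. real (diff_count p A x) * R ^ (l - 1))"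
    using R by (intro sum_mono2) auto
  also have "\<dots> = real (\<Sum>x\<in>{0..<int p}. diff_count p A x) * R ^ (l - 1)"
    by (simp add: sum_distrib_right)
  also have "(\<Sum>x\<in>{0..<int p}. diff_count p A x) = (card A)\<^sup>2"
    using p AB by (intro sum_diff_count) (auto intro: finite_subset)
  finally show ?thesis
    by simp
qed

section \<open>Absorption of logarithms and the final estimates\<close>

lemma one_plus_ln_le_powr:
  fixes x e :: real
  assumes "x \<ge> 1" "e > 0"
  shows "1 + ln x \<le> (1 + 1 / e) * x powr e"
proof -
  have "x powr e \<ge> 1"
    using assms by (intro ge_one_powr_ge_zero) auto
  then show ?thesis
    using ln_powr_bound[OF assms] by (simp add: algebra_simps)
qed

lemma le_if_square_le_times_powr:
  fixes x y D a :: real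
  assumes "x\<^sup>2 \<le> D * y powr (2 * a)" "D \<ge> 0" "y \<ge> 0"
  shows "x \<le> sqrt D * y powr a"
proof (rule power2_le_imp_le)
  have "y powr (2 * a) = (y powr a)\<^sup>2"
    by (simp add: power2_eq_square flip: powr_add)
  then have "(sqrt D * y powr a)\<^sup>2 = D * y powr (2 * a)"
    using assms by (simp add: power_mult_distrib)
  then show "x\<^sup>2 \<le> (sqrt D * y powr a)\<^sup>2"
    using assms(1) by simp
qed (use assms in simp)

text \<open>All ratios lie in G, so s^2 is at most 1600 t (1 + ln t). The logarithm costs t^(2 e),
  which becomes t^e after the square root.\<close>

lemma card_arith_progression_le:
  fixes e :: real
  assumes "prime p" "proper_mult_subgroup p G" "arith_progression p P" "P \<subseteq> G" and e: "e > 0"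
  shows "real (card P) \<le> sqrt (1600 * (1 + 1 / (2 * e))) * real (card G) powr (1 / 2 + e)"
proof -
  obtain a d where "mod_subprogression p G a d (card P)"
    using mod_subprogression_if_arith_progression assms by blast
  then interpret mod_subprogression p G a d "card P" .
  have PG: "card P \<le> card G"
    using assms finite by (intro card_mono)
  have W: "card consecutive_ratios \<le> card G"
    using finite by (intro card_mono) (auto simp: consecutive_ratios_def)
  have "(real (card P))\<^sup>2 \<le> 1600 * real (card consecutive_ratios) * (1 + ln (real (card P)))"
    by (rule length_square_le_consecutive_ratios)
  also have "\<dots> \<le> 1600 * real (card G) * (1 + ln (real (card G)))"
    using s PG W by (intro mult_mono add_mono) auto
  also have "\<dots> \<le> 1600 * real (card G) * ((1 + 1 / (2 * e)) * real (card G) powr (2 * e))"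
    using s PG e by (intro mult_left_mono one_plus_ln_le_powr) auto
  also have "\<dots> = 1600 * (1 + 1 / (2 * e)) * real (card G) powr (2 * (1 / 2 + e))"
    using card_pos by (simp add: powr_add distrib_left)
  finally show ?thesis
    using e by (intro le_if_square_le_times_powr) auto
qed

text \<open>The constant \<open>R\<close> does not depend on l and enters as a power, so that one
  choice covers both l = 2 and the given l.\<close>

lemma higher_energy_arith_progression_le:
  fixes e C :: real
  assumes e: "e > 0" and C: "C > 0"
  shows "\<exists>R\<ge>1. \<forall>p G P l. prime p \<longrightarrow> proper_mult_subgroup p G \<longrightarrow> real (card G) \<le> C * real p powr (2 / 3) \<longrightarrow>
    arith_progression p P \<longrightarrow> P \<subseteq> G \<longrightarrow> l \<ge> 2 \<longrightarrow>
    real (higher_energy p l P G) \<le> R ^ (l - 1) * real (card P) powr (1 + e) * real (card G) ^ (l - 1)"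
proof -
  obtain R where R: "R \<ge> 1" and st: "\<And>(p::nat) (t::nat) (A::int) B M. prime p \<Longrightarrow> t \<ge> 1 \<Longrightarrow>
      real t \<le> C * real p powr (2 / 3) \<Longrightarrow>
      \<not> int p dvd A \<Longrightarrow> \<not> int p dvd B \<Longrightarrow> M \<subseteq> {0..<int p} \<Longrightarrow>
      (\<forall>y\<in>M. [y ^ t = B] (mod int p) \<and> [(1 + y) ^ t = A] (mod int p)) \<Longrightarrow> card M \<le> t \<Longrightarrow>
      real (card M) \<le> R * real t powr (2 / 3)"
    using stepanov_bound[OF C] by blast
  define D where "D = sqrt (1600 * R * (1 + 1 / (2 * e)))"
  have D: "D \<ge> 0"
    using R e by (simp add: D_def)
  have "real (higher_energy p l P G) \<le> ((1 + D) * R) ^ (l - 1) * real (card P) powr (1 + e) * real (card G) ^ (l - 1)"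
    if p: "prime p" and G: "proper_mult_subgroup p G" and GC: "real (card G) \<le> C * real p powr (2 / 3)"
      and P: "arith_progression p P" "P \<subseteq> G" and l: "l \<ge> 2" for p G P l
  proof -
    obtain a d where "mod_subprogression p G a d (card P)"
      using mod_subprogression_if_arith_progression p G P by blast
    then interpret mod_subprogression p G a d "card P" .
    define t where "t = real (card G)"
    define u where "u = t powr (1 / 3)"
    define x where "x = real (card P)"
    have t: "t \<ge> 1"
      using card_pos by (simp add: t_def)
    have x: "x \<ge> 1"
      using s by (simp add: x_def)
    have u: "u \<ge> 1" "u ^ 3 = t" "t powr (2 / 3) = u\<^sup>2"
      using t by (simp_all add: u_def powr_power ge_one_powr_ge_zero)
    have Q: "real (card M) \<le> R * u\<^sup>2"
      if "\<not> int p dvd A" "\<not> int p dvd B" "M \<subseteq> {0..<int p}"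
        "\<forall>y\<in>M. [y ^ card G = B] (mod int p) \<and> [(1 + y) ^ card G = A] (mod int p)" "card M \<le> card G"
      for A B M
      using st[OF p _ GC that] card_pos u(3) by (simp add: t_def)
    have "x\<^sup>2 \<le> 1600 * real (card consecutive_ratios) * (1 + ln x)"
      unfolding x_def by (rule length_square_le_consecutive_ratios)
    also have "\<dots> \<le> 1600 * (R * u\<^sup>2) * ((1 + 1 / (2 * e)) * x powr (2 * e))"
      using x e R card_consecutive_ratios_le[OF Q]
      by (intro mult_mono one_plus_ln_le_powr) auto
    also have "\<dots> = (1600 * R * (1 + 1 / (2 * e)) * u\<^sup>2) * x powr (2 * e)"
      by simp
    finally have "x \<le> sqrt (1600 * R * (1 + 1 / (2 * e)) * u\<^sup>2) * x powr e"
      using R e x by (intro le_if_square_le_times_powr) auto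
    also have "\<dots> = D * u * x powr e"
      using u by (simp add: D_def real_sqrt_mult)
    finally have xD: "x \<le> D * u * x powr e" .
    define n where "n = l - 1"
    have n: "n \<ge> 1"
      using l by (simp add: n_def)
    have sub: "P \<subseteq> {0..<int p}" "G \<subseteq> {0..<int p}"
      using subset P(2) by auto
    have p1: "1 < p"
      using p by (rule prime_gt_1_nat)
    have "real (diff_count p G y) \<le> R * u\<^sup>2" if "0 < y" "y < int p" for y
    proof -
      have "\<not> int p dvd y"
        using that zdvd_not_zless by blast
      then have "real (card {(g, h) \<in> G \<times> G. [h = g + y] (mod int p)}) \<le> R * u\<^sup>2"
        by (rule card_differences_le) (rule Q)
      then show ?thesis
        using that by (simp only: diff_count_eq[OF p1])
    qed
    then have "real (higher_energy p l P G) \<le> x * t ^ n + x\<^sup>2 * (R * u\<^sup>2) ^ n"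
      unfolding x_def t_def n_def using R by (intro higher_energy_le[OF p1 sub]) auto
    also have "x\<^sup>2 * (R * u\<^sup>2) ^ n \<le> D * R ^ n * (x * x powr e) * t ^ n"
    proof -
      \<comment> \<open>Only one factor x is replaced by its bound D u x^e; its u, raised to u^n,
        completes u^(2 n) to t^n.\<close>
      have "x * x \<le> x * (D * u * x powr e)"
        using xD x by (intro mult_left_mono) auto
      also have "\<dots> \<le> x * (D * u ^ n * x powr e)"
        using x D u self_le_power[of u n] n by (intro mult_left_mono mult_right_mono) auto
      finally have "x\<^sup>2 * (R * u\<^sup>2) ^ n \<le> x * (D * u ^ n * x powr e) * (R * u\<^sup>2) ^ n"
        using R by (intro mult_right_mono) (auto simp: power2_eq_square)
      also have "\<dots> = D * R ^ n * (x * x powr e) * (u * u\<^sup>2) ^ n"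
        by (simp add: power_mult_distrib)
      finally show ?thesis
        by (simp add: u(2)[symmetric] power3_eq_cube power2_eq_square mult.assoc)
    qed
    also have "x * t ^ n \<le> R ^ n * (x * x powr e) * t ^ n"
    proof -
      have "1 * (x * 1) \<le> R ^ n * (x * x powr e)"
        using R x e by (intro mult_mono one_le_power ge_one_powr_ge_zero) auto
      then show ?thesis
        using t by (intro mult_right_mono) auto
    qed
    also have "R ^ n * (x * x powr e) * t ^ n + D * R ^ n * (x * x powr e) * t ^ n =
        (1 + D) ^ 1 * (R ^ n * (x * x powr e) * t ^ n)"
      by (simp add: algebra_simps)
    also have "\<dots> \<le> (1 + D) ^ n * (R ^ n * (x * x powr e) * t ^ n)"
      using D n R x t by (intro mult_right_mono power_increasing) auto
    also have "\<dots> = ((1 + D) * R) ^ n * x powr (1 + e) * t ^ n"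
      using x by (simp add: power_mult_distrib powr_add)
    finally show ?thesis
      unfolding x_def t_def n_def by simp
  qed
  moreover have "1 * 1 \<le> (1 + D) * R"
    using R D by (intro mult_mono) auto
  ultimately show ?thesis
    by (intro exI[of _ "(1 + D) * R"]) auto
qed

theorem corollary42:
  shows "(\<forall>\<epsilon>::real. \<epsilon> > 0 \<longrightarrow>
      (\<exists>C::real. C > 0 \<and>
        (\<forall>(p::nat) (\<Gamma>::int set) (P::int set).
          prime p \<longrightarrow> proper_mult_subgroup p \<Gamma> \<longrightarrow> arith_progression p P \<longrightarrow> P \<subseteq> \<Gamma> \<longrightarrow>
          real (card P) \<le> C * real (card \<Gamma>) powr (1 / 2 + \<epsilon>))))
    \<and>
    (\<forall>(\<epsilon>::real) (C::real) (l::nat). \<epsilon> > 0 \<longrightarrow> C > 0 \<longrightarrow> l \<ge> 3 \<longrightarrow>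
      (\<exists>C'::real. C' > 0 \<and>
        (\<forall>(p::nat) (\<Gamma>::int set) (P::int set).
          prime p \<longrightarrow> proper_mult_subgroup p \<Gamma> \<longrightarrow>
          2 \<le> card \<Gamma> \<longrightarrow> real (card \<Gamma>) \<le> C * real p powr (2 / 3) \<longrightarrow>
          arith_progression p P \<longrightarrow> P \<subseteq> \<Gamma> \<longrightarrow>
          real (energy p P \<Gamma>)
            \<le> C' * real (card P) powr (1 + \<epsilon>) * real (card \<Gamma>) * log 2 (real (card \<Gamma>)) powr (1 / 2)
          \<and>
          real (higher_energy p l P \<Gamma>)
            \<le> C' * real (card P) powr (1 + \<epsilon>) * real (card \<Gamma>) ^ (l - 1))))"
proof (intro conjI allI impI)
  fix \<epsilon> :: real assume e: "\<epsilon> > 0"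
  then have "sqrt (1600 * (1 + 1 / (2 * \<epsilon>))) > 0"
    by (simp add: add_pos_pos)
  then show "\<exists>C::real. C > 0 \<and> (\<forall>(p::nat) (\<Gamma>::int set) (P::int set).
      prime p \<longrightarrow> proper_mult_subgroup p \<Gamma> \<longrightarrow> arith_progression p P \<longrightarrow> P \<subseteq> \<Gamma> \<longrightarrow>
      real (card P) \<le> C * real (card \<Gamma>) powr (1 / 2 + \<epsilon>))"
    using card_arith_progression_le e by blast
next
  fix \<epsilon> C :: real and l :: nat
  assume e: "\<epsilon> > 0" and C: "C > 0" and l: "l \<ge> 3"
  obtain R where R: "R \<ge> 1" and bound: "\<And>p G P l. prime p \<Longrightarrow> proper_mult_subgroup p G \<Longrightarrow>
      real (card G) \<le> C * real p powr (2 / 3) \<Longrightarrow> arith_progression p P \<Longrightarrow> P \<subseteq> G \<Longrightarrow> l \<ge> 2 \<Longrightarrow>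
      real (higher_energy p l P G) \<le> R ^ (l - 1) * real (card P) powr (1 + \<epsilon>) * real (card G) ^ (l - 1)"
    using higher_energy_arith_progression_le[OF e C] by blast
  have "real (energy p P \<Gamma>)
        \<le> R ^ (l - 1) * real (card P) powr (1 + \<epsilon>) * real (card \<Gamma>) * log 2 (real (card \<Gamma>)) powr (1 / 2) \<and>
      real (higher_energy p l P \<Gamma>) \<le> R ^ (l - 1) * real (card P) powr (1 + \<epsilon>) * real (card \<Gamma>) ^ (l - 1)"
    if *: "prime p" "proper_mult_subgroup p \<Gamma>" "real (card \<Gamma>) \<le> C * real p powr (2 / 3)"
      "arith_progression p P" "P \<subseteq> \<Gamma>" and t: "2 \<le> card \<Gamma>" for p \<Gamma> P
  proof
    have "log 2 (real (card \<Gamma>)) \<ge> 1"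
      using t by simp
    then have log: "log 2 (real (card \<Gamma>)) powr (1 / 2) \<ge> 1"
      by (intro ge_one_powr_ge_zero) auto
    \<comment> \<open>The ordinary energy is the case l = 2; R \<ge> 1 then raises its constant R to
      the common R^(l-1), and the logarithmic factor is at least 1 since |\<Gamma>| \<ge> 2.\<close>
    have "real (energy p P \<Gamma>) = real (higher_energy p 2 P \<Gamma>)"
      by (simp add: energy_def higher_energy_def)
    also have "\<dots> \<le> R * (real (card P) powr (1 + \<epsilon>) * real (card \<Gamma>))"
      using bound[OF *, of 2] by simp
    also have "\<dots> \<le> R ^ (l - 1) * (real (card P) powr (1 + \<epsilon>) * real (card \<Gamma>))"
      using R l self_le_power[of R "l - 1"] by (intro mult_right_mono) auto
    also have "\<dots> \<le> R ^ (l - 1) * (real (card P) powr (1 + \<epsilon>) * real (card \<Gamma>)) * log 2 (real (card \<Gamma>)) powr (1 / 2)"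
      using mult_left_mono[OF log, of "R ^ (l - 1) * (real (card P) powr (1 + \<epsilon>) * real (card \<Gamma>))"] R by simp
    finally show "real (energy p P \<Gamma>)
        \<le> R ^ (l - 1) * real (card P) powr (1 + \<epsilon>) * real (card \<Gamma>) * log 2 (real (card \<Gamma>)) powr (1 / 2)"
      by (simp add: mult.assoc)
    show "real (higher_energy p l P \<Gamma>) \<le> R ^ (l - 1) * real (card P) powr (1 + \<epsilon>) * real (card \<Gamma>) ^ (l - 1)"
      using bound[OF *] l by simp
  qed
  moreover have "R ^ (l - 1) > 0"
    using R by simp
  ultimately show "\<exists>C'::real. C' > 0 \<and>
      (\<forall>(p::nat) (\<Gamma>::int set) (P::int set).
        prime p \<longrightarrow> proper_mult_subgroup p \<Gamma> \<longrightarrow>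
        2 \<le> card \<Gamma> \<longrightarrow> real (card \<Gamma>) \<le> C * real p powr (2 / 3) \<longrightarrow>
        arith_progression p P \<longrightarrow> P \<subseteq> \<Gamma> \<longrightarrow>
        real (energy p P \<Gamma>)
          \<le> C' * real (card P) powr (1 + \<epsilon>) * real (card \<Gamma>) * log 2 (real (card \<Gamma>)) powr (1 / 2)
        \<and>
        real (higher_energy p l P \<Gamma>)
          \<le> C' * real (card P) powr (1 + \<epsilon>) * real (card \<Gamma>) ^ (l - 1))"
    by blast
qed

end
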